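(* Fix a real number $a>0$. Then the series $\sum_{n=0}^\infty n!\,a^n$ is $C$-summable, and its $C$-sum is $$C\left(\sum_{n=0}^\infty n!\,a^n\right)=\frac{e^{-1/a}}{a}\,\mathrm{Ei}\!\left(\frac1a\right),$$ where the right-hand side is understood in the principal-value sense, i.e. $\mathrm{Ei}(x)=-PV\int_{-x}^\infty\frac{e^{-t}}{t}\,dt$ for $x>0$ (Cauchy principal value at $t=0$).
   Context: **Germs and log-exp monomials.** Functions are germs at $+\infty$ on the positive real axis: two are identified if they agree for all sufficiently large real $x$. Put $\ell_0(x)=x$, $\ell_{j+1}(x)=\log\ell_j(x)$. $\mathcal P$ is the group of germs $\prod_{j=0}^r\ell_j(x)^{\alpha_j}$, $\alpha_j\in\mathbb R$. Let $\mathcal L_0=\mathcal P$. Given $\mathcal L_{\le h}=\bigcup_{q=0}^h\mathcal L_q$, a reduced exponent of height at most $h$ is a finite (possibly empty) sum $\Phi=\sum_\nu c_\nu M_\nu$ with $c_\nu\in\mathbb R\setminus\{0\}$, the $M_\nu\in\mathcal L_{\le h}$ distinct, each $M_\nu(x)\to+\infty$, and no $M_\nu$ equal to an iterated logarithm $\ell_j$ with $j\ge1$. $\mathcal L_{h+1}$ is the set of germs $\exp(\Phi(x))P(x)$ with $P\in\mathcal P$ and $\Phi$ a reduced exponent of height at most $h$; $\mathcal L=\bigcup_{h\ge0}\mathcal L_h$. The reduced expression is part of the data of an element of $\mathcal L$. Write $f\prec g$ (or $g\succ f$) if $f(x)/g(x)\to0$ as $x\to+\infty$. Let $\mathcal L_{<x}=\{L\in\mathcal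 L:\log L(x)=o(x)\}$. $L\in\mathcal L$ is gamma-resonant if there are $\lambda\in\mathbb R$, $H\in\mathcal L_{<x}$, $\kappa>0$ and $C\in\mathbb R_{>0}$ with $L(x)/(e^{\lambda x}H(x)\Gamma(\kappa x+1))\to C$. **Growth monomials, $\mathcal M$, $\mathcal M^\flat$.** A growth monomial is either a pure log-exp germ $L\in\mathcal L$ that is not gamma-resonant, or a gamma-type germ $e^{\lambda x}H(x)\Gamma(\kappa x+1)$ with $\lambda\in\mathbb R$, $H\in\mathcal L_{<x}$, $\kappa>0$. $\mathcal M$ consists of the zero germ and all finite sums $\sum_{j=1}^r(A_j+B_je^{i\pi x})M_j(x)$ with growth monomials $M_1\succ\cdots\succ M_r$ and $(A_j,B_j)\in\mathbb C^2\setminus\{(0,0)\}$. $\mathcal M^\flat$ consists of the zero germ and all finite sums $\sum_{j=1}^rC_jM_j(x)$ with growth monomials $M_1\succ\cdots\succ M_r$ and $C_j\in\mathbb C\setminus\{0\}$. The phase split of $c=\sum_j(A_j+B_je^{i\pi x})M_j\in\mathcal M$ is $c=c^{(+)}+e^{i\pi x}c^{(-)}$ with $c^{(+)}=\sum_jA_jM_j$, $c^{(-)}=\sum_jB_jM_j\in\mathcal M^\flat$. **Canonical continuation.** A growth monomial is continued to some right half-plane by replacing $x$ by $z$ in its reduced expression (principal branches of iterated logarithms and powers; for gamma-type, $M(z)=e^{\lambda z}H(z)\Gamma(\kappa z+1)$). $a=\sum C_jM_j\in\mathcal M^\flat$ is continued by $a(z)=\sum C_jM_j(z)$; the zero germ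 by $0$. **Bromwich transform.** $a\in\mathcal M^\flat$ is Bromwich-admissible if there is $\sigma_0\in\mathbb R$ such that for every $\sigma>\sigma_0$: (1) $\mathcal B[a](u)=\frac1{2\pi i}\int_{\sigma-i\infty}^{\sigma+i\infty}a(z)e^{-uz}\,dz$ converges absolutely for almost every $u\in\mathbb R$; (2) $\mathcal B[a](u)$ does not depend on $\sigma>\sigma_0$; (3) for every sufficiently large integer $N$, $\int_{-\infty}^\infty\mathcal B[a](u)e^{Nu}\,du$ converges absolutely and equals $a(N)$. **Selectors.** For Bromwich-admissible $a$, $\mathcal S_+[a](N)=PV\int_{-\infty}^\infty\frac{\mathcal B[a](u)e^{Nu}}{1-e^u}du$, whenever the integral converges absolutely away from $u=0$ and the principal value $\lim_{\varepsilon\to0^+}\int_{|u|>\varepsilon}$ exists; $\mathcal S_-[a](N)=\int_{-\infty}^\infty\frac{\mathcal B[a](u)e^{Nu}}{1+e^u}du$, whenever it converges absolutely. $c\in\mathcal M$ admits a canonical selector if $c^{(\pm)}$ are Bromwich-admissible and $\mathcal S_+[c^{(+)}](N)$, $\mathcal S_-[c^{(-)}](N)$ exist for all sufficiently large $N$; then $U_c(N)=\mathcal S_+[c^{(+)}](N)+(-1)^N\mathcal S_-[c^{(-)}](N)$. **Admissibility and finite part.** A sequence $U$ (defined for large $N$) is shift-nonresonant if either $U_N\to0$ or there are $\varepsilon>0$, $N_0$ with $|U_N-U_{N+1}|\ge\varepsilon|U_N|$ for $N\ge N_0$. For a complex sequence $R=(R_N)_{N\ge0}$ put $c_N=R_N-R_{N+1}$.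 $R$ is $\mathcal M$-admissible if either $c_N=0$ for all large $N$, or there is $c\in\mathcal M$ with $c(N)=c_N$ for all large integers $N$ which admits a canonical selector $U_c$ that is shift-nonresonant (such $c$ is unique). For $\mathcal M$-admissible $R$, $\mathrm{FP}_\infty(R)$ is the eventual constant value of $R_N$ if $c_N=0$ eventually, and otherwise the eventual constant value of $R_N-U_c(N)$. **$C$-summation.** A recurrence presentation of a formal series $\sum_{k\ge0}c_k$ consists of $n_0\in\mathbb N$, functions $a,b:\mathbb N\to\mathbb C$ with $a(n),b(n)\ne0$ for $n\ge n_0$, and complex $\mu_n$ such that $c_k=(-1)^k\mu_{n_0+k}\prod_{j=0}^{k-1}\frac{b(n_0+j)}{a(n_0+j+1)}$ for all $k\ge0$ (empty product $=1$). Put $P(n,n_0)=\prod_{k=n_0}^{n-1}(-a(k)/b(k))$. For a solution $(I_n)_{n\ge n_0}$ of $a(n)I_n+b(n)I_{n+1}=\mu_n$ the normalized tail is $R_N=a(n_0)I_{n_0+N}/P(n_0+N,n_0)$. The series is $C$-summable if some presentation has a solution with $\mathcal M$-admissible normalized tail $R$; its $C$-sum is then $C(\sum c_k)=a(n_0)I_{n_0}-\mathrm{FP}_\infty(R)$ (a value independent of the presentation and solution). *)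

theory Defs
  imports "HOL-Analysis.Analysis" "HOL-Library.Landau_Symbols"
begin

section \<open>Germs at infinity and log-exp monomials\<close>

text \<open>
  Germs are represented by functions on the reals, so two functions stand for the same germ iff
  they are related by \<open>germ_eq\<close>.
\<close>

definition germ_eq :: "(real \<Rightarrow> real) \<Rightarrow> (real \<Rightarrow> real) \<Rightarrow> bool" where
  "germ_eq f g \<longleftrightarrow> (\<forall>\<^sub>F x in at_top. f x = g x)"

definition germ_prec :: "(real \<Rightarrow> real) \<Rightarrow> (real \<Rightarrow> real) \<Rightarrow> bool" where
  "germ_prec f g \<longleftrightarrow> ((\<lambda>x. f x / g x) \<longlongrightarrow> 0) at_top"

text \<open>The iterated logarithms; at type \<^typ>\<open>complex\<close> they use the principal branch.\<close>

definition iter_log :: "nat \<Rightarrow> 'a::ln \<Rightarrow> 'a" where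
  "iter_log j x = (ln ^^ j) x"

text \<open>
  The reduced expression of an element of \<open>\<L>\<close> is part of its data (the continuation is read off
  from it), so the elements are expressions:
  \<open>LExp [(c\<^sub>1, M\<^sub>1), \<dots>, (c\<^sub>n, M\<^sub>n)] [\<alpha>\<^sub>0, \<dots>, \<alpha>\<^sub>r]\<close> stands for
  \<open>exp (c\<^sub>1 M\<^sub>1 + \<dots> + c\<^sub>n M\<^sub>n)\<close> times the product of the \<open>\<ell>\<^sub>j\<close> to the power \<open>\<alpha>\<^sub>j\<close>.
\<close>

datatype lexp = LExp "(real \<times> lexp) list" "real list"

fun lval :: "lexp \<Rightarrow> real \<Rightarrow> real" where
  "lval (LExp \<Phi> \<alpha>) x =
     exp (\<Sum>(c, M)\<leftarrow>\<Phi>. c * lval M x) * (\<Prod>j<length \<alpha>. iter_log j x powr (\<alpha> ! j))"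

fun lcont :: "lexp \<Rightarrow> complex \<Rightarrow> complex" where
  "lcont (LExp \<Phi> \<alpha>) z =
     exp (\<Sum>(c, M)\<leftarrow>\<Phi>. of_real c * lcont M z) *
     (\<Prod>j<length \<alpha>. iter_log j z powr of_real (\<alpha> ! j))"

text \<open>Distinctness of the monomials in an exponent is distinctness of germs.\<close>

definition reduced_exponent :: "lexp set \<Rightarrow> (real \<times> lexp) list \<Rightarrow> bool" where
  "reduced_exponent S \<Phi> \<longleftrightarrow>
     (\<forall>(c, M)\<in>set \<Phi>. c \<noteq> 0 \<and> M \<in> S \<and> filterlim (lval M) at_top at_top \<and>
        (\<forall>j\<ge>1. \<not> germ_eq (lval M) (iter_log j))) \<and>
     sorted_wrt (\<lambda>(_, M) (_, M'). \<not> germ_eq (lval M) (lval M')) \<Phi>"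

primrec logexp_upto :: "nat \<Rightarrow> lexp set" where
  "logexp_upto 0 = {LExp [] \<alpha> | \<alpha>. True}"
| "logexp_upto (Suc h) =
     logexp_upto h \<union> {LExp \<Phi> \<alpha> | \<Phi> \<alpha>. reduced_exponent (logexp_upto h) \<Phi>}"

definition logexp :: "lexp set" where
  "logexp = (\<Union>h. logexp_upto h)"

definition logexp_lt_x :: "lexp set" where
  "logexp_lt_x = {L \<in> logexp. (\<lambda>x. ln (lval L x)) \<in> o[at_top](\<lambda>x. x)}"

definition gamma_resonant :: "lexp \<Rightarrow> bool" where
  "gamma_resonant L \<longleftrightarrow>
     (\<exists>l. \<exists>H\<in>logexp_lt_x. \<exists>\<kappa>>0. \<exists>C>0.
        ((\<lambda>x. lval L x / (exp (l * x) * lval H x * Gamma (\<kappa> * x + 1))) \<longlongrightarrow> C) at_top)"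


section \<open>Growth monomials and their finite sums\<close>

text \<open>\<open>Gamma_Type l H \<kappa>\<close> stands for \<open>exp (l x) H(x) \<Gamma>(\<kappa> x + 1)\<close>.\<close>

datatype gmon = Pure_LE lexp | Gamma_Type real lexp real

primrec growth_monomial :: "gmon \<Rightarrow> bool" where
  "growth_monomial (Pure_LE L) \<longleftrightarrow> L \<in> logexp \<and> \<not> gamma_resonant L"
| "growth_monomial (Gamma_Type l H \<kappa>) \<longleftrightarrow> H \<in> logexp_lt_x \<and> \<kappa> > 0"

primrec gval :: "gmon \<Rightarrow> real \<Rightarrow> real" where
  "gval (Pure_LE L) x = lval L x"
| "gval (Gamma_Type l H \<kappa>) x = exp (l * x) * lval H x * Gamma (\<kappa> * x + 1)"

primrec gcont :: "gmon \<Rightarrow> complex \<Rightarrow> complex" where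
  "gcont (Pure_LE L) z = lcont L z"
| "gcont (Gamma_Type l H \<kappa>) z = exp (of_real l * z) * lcont H z * Gamma (of_real \<kappa> * z + 1)"

text \<open>
  An element of \<open>\<M>\<close> is given by the list of its \<open>(A\<^sub>j, B\<^sub>j, M\<^sub>j)\<close>, an element of \<open>\<M>\<^sup>\<flat>\<close> by the list
  of its \<open>(C\<^sub>j, M\<^sub>j)\<close>; the empty list is the zero germ.
\<close>

type_synonym msum = "(complex \<times> complex \<times> gmon) list"
type_synonym fsum = "(complex \<times> gmon) list"

definition mspace :: "msum set" where
  "mspace = {c. (\<forall>(A, B, M)\<in>set c. (A, B) \<noteq> (0, 0) \<and> growth_monomial M) \<and>
     sorted_wrt (\<lambda>(_, _, M) (_, _, M'). germ_prec (gval M') (gval M)) c}"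

definition mflat :: "fsum set" where
  "mflat = {a. (\<forall>(C, M)\<in>set a. C \<noteq> 0 \<and> growth_monomial M) \<and>
     sorted_wrt (\<lambda>(_, M) (_, M'). germ_prec (gval M') (gval M)) a}"

definition mval :: "msum \<Rightarrow> real \<Rightarrow> complex" where
  "mval c x = (\<Sum>(A, B, M)\<leftarrow>c. (A + B * exp (\<i> * of_real (pi * x))) * of_real (gval M x))"

definition fval :: "fsum \<Rightarrow> real \<Rightarrow> complex" where
  "fval a x = (\<Sum>(C, M)\<leftarrow>a. C * of_real (gval M x))"

definition fcont :: "fsum \<Rightarrow> complex \<Rightarrow> complex" where
  "fcont a z = (\<Sum>(C, M)\<leftarrow>a. C * gcont M z)"

text \<open>The phase split; terms with coefficient 0 are dropped so that the parts are in \<open>\<M>\<^sup>\<flat>\<close>.\<close>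

definition plus_part :: "msum \<Rightarrow> fsum" where
  "plus_part c = filter (\<lambda>(C, _). C \<noteq> 0) (map (\<lambda>(A, B, M). (A, M)) c)"

definition minus_part :: "msum \<Rightarrow> fsum" where
  "minus_part c = filter (\<lambda>(C, _). C \<noteq> 0) (map (\<lambda>(A, B, M). (B, M)) c)"


section \<open>Bromwich transform and selectors\<close>

text \<open>
  The line from \<open>\<sigma> - \<i>\<infinity>\<close> to \<open>\<sigma> + \<i>\<infinity>\<close> is parametrised by \<open>z = \<sigma> + \<i>t\<close>, \<open>dz = \<i> dt\<close>. Absolute
  convergence of an integral is Lebesgue integrability.
\<close>

definition bromwich_integrand :: "fsum \<Rightarrow> real \<Rightarrow> real \<Rightarrow> real \<Rightarrow> complex" where
  "bromwich_integrand a \<sigma> u t =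
     fcont a (Complex \<sigma> t) * exp (- (of_real u * Complex \<sigma> t)) * \<i>"

definition bromwich_line :: "fsum \<Rightarrow> real \<Rightarrow> real \<Rightarrow> complex" where
  "bromwich_line a \<sigma> u =
     1 / (2 * of_real pi * \<i>) * (LINT t|lborel. bromwich_integrand a \<sigma> u t)"

text \<open>The common value of the line integrals for all large \<open>\<sigma>\<close>.\<close>

definition bromwich :: "fsum \<Rightarrow> real \<Rightarrow> complex" where
  "bromwich a u = (THE v. \<forall>\<^sub>F \<sigma> in at_top. bromwich_line a \<sigma> u = v)"

text \<open>
  The modulus of the integrand depends on \<open>u\<close> only through a constant factor, so convergence for
  almost every \<open>u\<close> is convergence for every \<open>u\<close>. This is why independence of \<open>\<sigma>\<close> can be
  required for every \<open>u\<close>.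
\<close>

definition bromwich_admissible :: "fsum \<Rightarrow> bool" where
  "bromwich_admissible a \<longleftrightarrow> a \<in> mflat \<and>
     (\<exists>\<sigma>\<^sub>0. \<forall>\<sigma>>\<sigma>\<^sub>0.
        (AE u in lborel. integrable lborel (bromwich_integrand a \<sigma> u)) \<and>
        (\<forall>\<tau>>\<sigma>\<^sub>0. \<forall>u. bromwich_line a \<sigma> u = bromwich_line a \<tau> u) \<and>
        (\<forall>\<^sub>F N in sequentially.
           integrable lborel (\<lambda>u. bromwich a u * of_real (exp (real N * u))) \<and>
           (LINT u|lborel. bromwich a u * of_real (exp (real N * u))) = fval a (real N)))"

text \<open>Principal value integrals over \<open>S\<close> with the singularity at 0.\<close>

definition has_PV :: "real set \<Rightarrow> (real \<Rightarrow> 'a) \<Rightarrow> 'a::{banach, second_countable_topology} \<Rightarrow> bool" where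
  "has_PV S f v \<longleftrightarrow>
     (\<forall>\<epsilon>>0. set_integrable lborel (S \<inter> {u. \<bar>u\<bar> > \<epsilon>}) f) \<and>
     ((\<lambda>\<epsilon>. LINT u:S \<inter> {u. \<bar>u\<bar> > \<epsilon>}|lborel. f u) \<longlongrightarrow> v) (at_right 0)"

definition PV_integral :: "real set \<Rightarrow> (real \<Rightarrow> 'a) \<Rightarrow> 'a::{banach, second_countable_topology}" where
  "PV_integral S f = (THE v. has_PV S f v)"

definition plus_integrand :: "fsum \<Rightarrow> nat \<Rightarrow> real \<Rightarrow> complex" where
  "plus_integrand a N u = bromwich a u * of_real (exp (real N * u)) / of_real (1 - exp u)"

definition minus_integrand :: "fsum \<Rightarrow> nat \<Rightarrow> real \<Rightarrow> complex" where
  "minus_integrand a N u = bromwich a u * of_real (exp (real N * u)) / of_real (1 + exp u)"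

definition S_plus :: "fsum \<Rightarrow> nat \<Rightarrow> complex" where
  "S_plus a N = PV_integral UNIV (plus_integrand a N)"

definition S_minus :: "fsum \<Rightarrow> nat \<Rightarrow> complex" where
  "S_minus a N = (LINT u|lborel. minus_integrand a N u)"

definition admits_selector :: "msum \<Rightarrow> bool" where
  "admits_selector c \<longleftrightarrow>
     bromwich_admissible (plus_part c) \<and> bromwich_admissible (minus_part c) \<and>
     (\<forall>\<^sub>F N in sequentially. (\<exists>v. has_PV UNIV (plus_integrand (plus_part c) N) v) \<and>
        integrable lborel (minus_integrand (minus_part c) N))"

definition selector :: "msum \<Rightarrow> nat \<Rightarrow> complex" where
  "selector c N = S_plus (plus_part c) N + (-1) ^ N * S_minus (minus_part c) N"


section \<open>Admissible sequences and finite parts\<close>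

definition shift_nonresonant :: "(nat \<Rightarrow> complex) \<Rightarrow> bool" where
  "shift_nonresonant U \<longleftrightarrow> U \<longlonglongrightarrow> 0 \<or>
     (\<exists>\<epsilon>>0. \<exists>N\<^sub>0. \<forall>N\<ge>N\<^sub>0. norm (U N - U (Suc N)) \<ge> \<epsilon> * norm (U N))"

definition M_interpolant :: "(nat \<Rightarrow> complex) \<Rightarrow> msum \<Rightarrow> bool" where
  "M_interpolant R c \<longleftrightarrow> c \<in> mspace \<and>
     (\<forall>\<^sub>F N in sequentially. mval c (real N) = R N - R (Suc N)) \<and>
     admits_selector c \<and> shift_nonresonant (selector c)"

definition M_admissible :: "(nat \<Rightarrow> complex) \<Rightarrow> bool" where
  "M_admissible R \<longleftrightarrow>
     (\<forall>\<^sub>F N in sequentially. R N - R (Suc N) = 0) \<or> (\<exists>c. M_interpolant R c)"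

definition has_FP :: "(nat \<Rightarrow> complex) \<Rightarrow> complex \<Rightarrow> bool" where
  "has_FP R v \<longleftrightarrow>
     (if \<forall>\<^sub>F N in sequentially. R N - R (Suc N) = 0
      then \<forall>\<^sub>F N in sequentially. R N = v
      else \<exists>c. M_interpolant R c \<and> (\<forall>\<^sub>F N in sequentially. R N - selector c N = v))"

definition FP_infinity :: "(nat \<Rightarrow> complex) \<Rightarrow> complex" where
  "FP_infinity R = (THE v. has_FP R v)"


section \<open>C-summation\<close>

definition recurrence_presentation ::
  "(nat \<Rightarrow> complex) \<Rightarrow> nat \<Rightarrow> (nat \<Rightarrow> complex) \<Rightarrow> (nat \<Rightarrow> complex) \<Rightarrow> (nat \<Rightarrow> complex) \<Rightarrow> bool" where
  "recurrence_presentation s n\<^sub>0 a b \<mu> \<longleftrightarrow>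
     (\<forall>n\<ge>n\<^sub>0. a n \<noteq> 0 \<and> b n \<noteq> 0) \<and>
     (\<forall>k. s k = (-1) ^ k * \<mu> (n\<^sub>0 + k) * (\<Prod>j<k. b (n\<^sub>0 + j) / a (n\<^sub>0 + j + 1)))"

definition recurrence_solution ::
  "nat \<Rightarrow> (nat \<Rightarrow> complex) \<Rightarrow> (nat \<Rightarrow> complex) \<Rightarrow> (nat \<Rightarrow> complex) \<Rightarrow> (nat \<Rightarrow> complex) \<Rightarrow> bool" where
  "recurrence_solution n\<^sub>0 a b \<mu> I \<longleftrightarrow> (\<forall>n\<ge>n\<^sub>0. a n * I n + b n * I (Suc n) = \<mu> n)"

definition recurrence_prod :: "(nat \<Rightarrow> complex) \<Rightarrow> (nat \<Rightarrow> complex) \<Rightarrow> nat \<Rightarrow> nat \<Rightarrow> complex" where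
  "recurrence_prod a b n n\<^sub>0 = (\<Prod>k\<in>{n\<^sub>0..<n}. - a k / b k)"

definition normalized_tail ::
  "nat \<Rightarrow> (nat \<Rightarrow> complex) \<Rightarrow> (nat \<Rightarrow> complex) \<Rightarrow> (nat \<Rightarrow> complex) \<Rightarrow> nat \<Rightarrow> complex" where
  "normalized_tail n\<^sub>0 a b I N = a n\<^sub>0 * I (n\<^sub>0 + N) / recurrence_prod a b (n\<^sub>0 + N) n\<^sub>0"

text \<open>A formal series is given by its sequence of terms.\<close>

definition has_C_sum :: "(nat \<Rightarrow> complex) \<Rightarrow> complex \<Rightarrow> bool" where
  "has_C_sum s v \<longleftrightarrow>
     (\<exists>n\<^sub>0 a b \<mu> I. recurrence_presentation s n\<^sub>0 a b \<mu> \<and> recurrence_solution n\<^sub>0 a b \<mu> I \<and>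
        M_admissible (normalized_tail n\<^sub>0 a b I) \<and>
        v = a n\<^sub>0 * I n\<^sub>0 - FP_infinity (normalized_tail n\<^sub>0 a b I))"

definition C_summable :: "(nat \<Rightarrow> complex) \<Rightarrow> bool" where
  "C_summable s \<longleftrightarrow>
     (\<exists>n\<^sub>0 a b \<mu> I. recurrence_presentation s n\<^sub>0 a b \<mu> \<and> recurrence_solution n\<^sub>0 a b \<mu> I \<and>
        M_admissible (normalized_tail n\<^sub>0 a b I))"

definition C_sum :: "(nat \<Rightarrow> complex) \<Rightarrow> complex" where
  "C_sum s = (THE v. has_C_sum s v)"


section \<open>The exponential integral\<close>

text \<open>Intended for positive \<open>x\<close>.\<close>

definition Ei :: "real \<Rightarrow> real" where
  "Ei x = - PV_integral {-x..} (\<lambda>t. exp (- t) / t)"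

end

theory Submission
  imports Defs "HOL-Real_Asymp.Real_Asymp" "HOL-Probability.Characteristic_Functions"
    "HOL-Probability.Sinc_Integral"
begin

text \<open>
  For every presentation and solution the normalized tail satisfies
  \<open>R\<^sub>N - R\<^sub>N\<^sub>+\<^sub>1 = N! a\<^sup>N\<close>, so everything reduces to two questions about \<open>c(x) = a\<^sup>x \<Gamma>(x + 1)\<close>.

  Its Bromwich transform is \<open>\<B>[c](u) = w exp (- w)\<close> with \<open>w = exp u / a\<close>: this is Mellin
  inversion for \<open>\<Gamma>\<close>, i.e. Fourier inversion on a vertical line, where \<open>\<Gamma>\<close> is integrable because
  \<open>\<Gamma>(s) = \<Gamma>(s + 2) / (s (s + 1))\<close>. The substitution \<open>t = (exp u - 1) / a\<close> identifies \<open>\<S>\<^sub>+[c](0)\<close> with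
  the asserted value, and \<open>\<S>\<^sub>+[c](N) - \<S>\<^sub>+[c](N + 1) = N! a\<^sup>N\<close> because the factor \<open>1 - exp u\<close> cancels.

  No other element of \<open>\<M>\<close> interpolates \<open>N! a\<^sup>N\<close>: the logarithm of a log-exp monomial is a linear
  combination of pairwise comparable monomials tending to infinity, and so is that of a gamma
  monomial up to a constant and \<open>o(1)\<close>, by Stirling's formula. Such a combination is eventually 0 or
  tends to \<open>\<plusminus>\<infinity>\<close>, so boundedness along a subsequence of the integers forces it to vanish. This
  leaves only representations of \<open>c\<close> itself, which share its continuation far to the right.
\<close>


section \<open>Linear combinations over an asymptotic scale\<close>

text \<open>\<open>C_sum\<close>, \<open>FP_infinity\<close> and \<open>bromwich\<close> are
  definite descriptions, so a value can be computed only together with its uniqueness: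
  \<open>has_FP\<close> accepts every interpolant, and the selector must agree for all of them. The
  selector reads the continuation off an expression, whereas interpolation constrains only values at
  integers; hence two rigidity statements are needed. One passes from integers to germs and gives a
  gamma monomial with \<open>H\<close> eventually 1; here the exclusion of gamma-resonant log-exp
  germs removes the competitor. The other passes from the germ 1 to its expression: reduced
  exponents have distinct monomials and contain no iterated logarithm, so they cannot cancel against
  the logarithms of the power factors, and only exponents 0 survive. This still leaves infinitely
  many expressions, since factors with exponent 0 may be appended, and their continuations may
  differ where an iterated logarithm vanishes; \<open>bromwich\<close> depends only on large
  abscissas and does not see this.\<close>

definition asym_scale :: "(real \<Rightarrow> real) set \<Rightarrow> bool" where
  "asym_scale G \<longleftrightarrow> (\<forall>f\<in>G. filterlim f at_top at_top) \<and>
     (\<forall>f\<in>G. \<forall>g\<in>G. germ_eq f g \<or> germ_prec f g \<or> germ_prec g f)"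

text \<open>A list, since the difference of two logarithms may contain the same germ several times,
  with coefficients that cancel.\<close>

definition lincomb :: "(real \<times> (real \<Rightarrow> real)) list \<Rightarrow> real \<Rightarrow> real" where
  "lincomb xs x = (\<Sum>(c, g)\<leftarrow>xs. c * g x)"

lemma lincomb_Nil [simp]: "lincomb [] x = 0"
  and lincomb_Cons [simp]: "lincomb ((c, g) # xs) x = c * g x + lincomb xs x"
  and lincomb_append [simp]: "lincomb (xs @ ys) x = lincomb xs x + lincomb ys x"
  by (simp_all add: lincomb_def)

lemma germ_eq_refl [simp]: "germ_eq f f"
  by (simp add: germ_eq_def)

lemma germ_eq_sym: "germ_eq f g \<Longrightarrow> germ_eq g f"
  by (auto simp: germ_eq_def elim: eventually_mono)

lemma germ_eq_trans: "germ_eq f g \<Longrightarrow> germ_eq g h \<Longrightarrow> germ_eq f h"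
  unfolding germ_eq_def by (auto elim: eventually_elim2)

lemma germ_eq_imp_div_tendsto_1:
  assumes "germ_eq f g" "filterlim g at_top at_top"
  shows "((\<lambda>x. f x / g x) \<longlongrightarrow> 1) at_top"
proof -
  have "\<forall>\<^sub>F x in at_top. g x > 0"
    using assms(2) by (auto simp: filterlim_at_top_dense)
  with assms(1) have "\<forall>\<^sub>F x in at_top. 1 = f x / g x"
    unfolding germ_eq_def by eventually_elim simp
  then show ?thesis
    by (rule Lim_transform_eventually[rotated]) auto
qed

lemma germ_prec_cong:
  assumes "germ_eq f f'" "germ_eq g g'"
  shows "germ_prec f g \<longleftrightarrow> germ_prec f' g'"
  unfolding germ_prec_def
  by (rule tendsto_cong) (use assms in \<open>auto simp: germ_eq_def elim: eventually_elim2\<close>)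

lemma germ_prec_trans:
  assumes "germ_prec f g" "germ_prec g h" "filterlim g at_top at_top"
  shows "germ_prec f h"
proof -
  have "((\<lambda>x. (f x / g x) * (g x / h x)) \<longlongrightarrow> 0 * 0) at_top"
    using assms(1,2) unfolding germ_prec_def by (rule tendsto_mult)
  moreover have "\<forall>\<^sub>F x in at_top. g x > 0"
    using assms(3) by (auto simp: filterlim_at_top_dense)
  then have "\<forall>\<^sub>F x in at_top. (f x / g x) * (g x / h x) = f x / h x"
    by eventually_elim auto
  ultimately show ?thesis
    unfolding germ_prec_def using Lim_transform_eventually by fastforce
qed

text \<open>Comparability is total up to germ equality and \<open>germ_prec\<close> is transitive,
  so a new head either lies below the current maximum or replaces it.\<close>

lemma asym_scale_max:
  assumes "asym_scale G" "snd ` set xs \<subseteq> G" "xs \<noteq> []"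
  shows "\<exists>g\<in>snd ` set xs. \<forall>f\<in>snd ` set xs. germ_eq f g \<or> germ_prec f g"
  using assms(2,3)
proof (induction xs)
  case (Cons y ys)
  show ?case
  proof (cases "ys = []")
    case True
    then show ?thesis by auto
  next
    case False
    with Cons obtain g where g: "g \<in> snd ` set ys"
      "\<And>f. f \<in> snd ` set ys \<Longrightarrow> germ_eq f g \<or> germ_prec f g"
      by auto
    have G: "snd y \<in> G" "g \<in> G" "snd ` set ys \<subseteq> G"
      using Cons.prems g(1) by auto
    then have lim: "filterlim g at_top at_top"
      using assms(1) by (auto simp: asym_scale_def)
    consider "germ_eq (snd y) g \<or> germ_prec (snd y) g" | "germ_prec g (snd y)"
      using assms(1) G unfolding asym_scale_def by blast
    then show ?thesis
    proof cases
      case 1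
      then show ?thesis using g by auto
    next
      case 2
      have "germ_eq f (snd y) \<or> germ_prec f (snd y)" if "f \<in> snd ` set ys" for f
        using g(2)[OF that]
      proof
        assume "germ_eq f g"
        then show ?thesis
          using 2 germ_prec_cong[of f g "snd y" "snd y"] by simp
      next
        assume "germ_prec f g"
        then show ?thesis
          using 2 germ_prec_trans[OF _ _ lim] by blast
      qed
      then show ?thesis by auto
    qed
  qed
qed simp

lemma lincomb_div_dominant:
  assumes "\<forall>f\<in>snd ` set xs. germ_eq f g \<or> germ_prec f g" "filterlim g at_top at_top"
  shows "((\<lambda>x. lincomb xs x / g x) \<longlongrightarrow> (\<Sum>(c, f)\<leftarrow>xs. if germ_eq f g then c else 0)) at_top"
  using assms(1)
proof (induction xs)
  case (Cons y ys)
  obtain c f where y: "y = (c, f)" by force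
  have "((\<lambda>x. f x / g x) \<longlongrightarrow> (if germ_eq f g then 1 else 0)) at_top"
    using Cons.prems germ_eq_imp_div_tendsto_1[OF _ assms(2), of f] by (auto simp: y germ_prec_def)
  then have "((\<lambda>x. c * (f x / g x)) \<longlongrightarrow> c * (if germ_eq f g then 1 else 0)) at_top"
    by (intro tendsto_intros)
  moreover have "((\<lambda>x. lincomb ys x / g x) \<longlongrightarrow> (\<Sum>(c, f)\<leftarrow>ys. if germ_eq f g then c else 0)) at_top"
    using Cons by auto
  ultimately have "((\<lambda>x. c * (f x / g x) + lincomb ys x / g x) \<longlongrightarrow>
      c * (if germ_eq f g then 1 else 0) + (\<Sum>(c, f)\<leftarrow>ys. if germ_eq f g then c else 0)) at_top"
    by (rule tendsto_add)
  then show ?case by (cases "germ_eq f g") (simp_all add: y add_divide_distrib)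
qed simp

text \<open>If the coefficients of the class of \<open>g\<close> cancel, the whole class drops out
  and a shorter combination with the same germ remains.\<close>

lemma lincomb_germ_eq_class:
  "\<forall>\<^sub>F x in at_top. lincomb xs x =
     (\<Sum>(c, f)\<leftarrow>xs. if germ_eq f g then c else 0) * g x +
     lincomb (filter (\<lambda>(c, f). \<not> germ_eq f g) xs) x"
proof (induction xs)
  case (Cons y ys)
  obtain c f where y: "y = (c, f)" by force
  show ?case
  proof (cases "germ_eq f g")
    case True
    then have "\<forall>\<^sub>F x in at_top. f x = g x" by (simp add: germ_eq_def)
    with Cons.IH show ?thesis
      by eventually_elim (simp add: y True distrib_right)
  next
    case False
    with Cons.IH show ?thesis
      by (auto simp: y elim: eventually_mono)
  qed
qed simp

text \<open>The dominant class of the terms either has a nonzero total coefficient, or it cancels and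
  can be removed from the combination.\<close>

lemma lincomb_asym_scale:
  assumes "asym_scale G" "snd ` set xs \<subseteq> G"
  shows "(\<forall>\<^sub>F x in at_top. lincomb xs x = 0) \<or>
    (\<exists>g\<in>G. \<exists>c. c \<noteq> 0 \<and> ((\<lambda>x. lincomb xs x / g x) \<longlongrightarrow> c) at_top)"
  using assms(2)
proof (induction "length xs" arbitrary: xs rule: less_induct)
  case less
  show ?case
  proof (cases "xs = []")
    case False
    obtain g where g: "g \<in> snd ` set xs" "\<forall>f\<in>snd ` set xs. germ_eq f g \<or> germ_prec f g"
      using asym_scale_max[OF assms(1) less.prems False] by blast
    define C where "C = (\<Sum>(c, f)\<leftarrow>xs. if germ_eq f g then c else 0)"
    define ys where "ys = filter (\<lambda>(c, f). \<not> germ_eq f g) xs"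
    have gG: "g \<in> G" using g less.prems by auto
    then have lim: "filterlim g at_top at_top"
      using assms(1) by (auto simp: asym_scale_def)
    show ?thesis
    proof (cases "C = 0")
      case False
      then show ?thesis
        using lincomb_div_dominant[OF g(2) lim] gG unfolding C_def by blast
    next
      case True
      have eq: "\<forall>\<^sub>F x in at_top. lincomb xs x = lincomb ys x"
        using lincomb_germ_eq_class[of xs g] True unfolding ys_def C_def by simp
      \<comment> \<open>The filter removes at least the entry \<open>g\<close> itself, so the
        induction on the length applies.\<close>
      obtain p where "p \<in> set xs" "snd p = g" using g(1) by auto
      then have "length ys < length xs"
        unfolding ys_def by (intro length_filter_less[of p]) (auto simp: case_prod_beta)
      moreover have "snd ` set ys \<subseteq> G"
        using less.prems by (auto simp: ys_def)
      ultimately consider "\<forall>\<^sub>F x in at_top. lincomb ys x = 0"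
        | h c where "h \<in> G" "c \<noteq> 0" "((\<lambda>x. lincomb ys x / h x) \<longlongrightarrow> c) at_top"
        using less.hyps by blast
      then show ?thesis
      proof cases
        case 1
        with eq have "\<forall>\<^sub>F x in at_top. lincomb xs x = 0"
          by eventually_elim simp
        then show ?thesis ..
      next
        case 2
        have "((\<lambda>x. lincomb xs x / h x) \<longlongrightarrow> c) at_top \<longleftrightarrow>
              ((\<lambda>x. lincomb ys x / h x) \<longlongrightarrow> c) at_top"
          by (rule tendsto_cong) (use eq in \<open>auto elim: eventually_mono\<close>)
        with 2 show ?thesis by blast
      qed
    qed
  qed simp
qed

lemma lincomb_asym_scale_limit:
  assumes "asym_scale G" "snd ` set xs \<subseteq> G"
  shows "(\<forall>\<^sub>F x in at_top. lincomb xs x = 0) \<or>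
    filterlim (lincomb xs) at_top at_top \<or> filterlim (lincomb xs) at_bot at_top"
proof -
  have "filterlim (lincomb xs) at_top at_top \<or> filterlim (lincomb xs) at_bot at_top"
    if g: "g \<in> G" "c \<noteq> 0" "((\<lambda>x. lincomb xs x / g x) \<longlongrightarrow> c) at_top" for g c
  proof -
    have lim: "filterlim g at_top at_top"
      using assms(1) g by (auto simp: asym_scale_def)
    have "\<forall>\<^sub>F x in at_top. g x > 0"
      using lim by (auto simp: filterlim_at_top_dense)
    then have eq: "\<forall>\<^sub>F x in at_top. lincomb xs x / g x * g x = lincomb xs x"
      by eventually_elim simp
    consider "c > 0" | "c < 0" using g by linarith
    then show ?thesis
    proof cases
      case 1
      from filterlim_tendsto_pos_mult_at_top[OF g(3) 1 lim]
      show ?thesis using filterlim_cong[OF refl refl eq] by blast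
    next
      case 2
      from filterlim_tendsto_neg_mult_at_bot[OF g(3) 2 lim]
      show ?thesis using filterlim_cong[OF refl refl eq] by blast
    qed
  qed
  with lincomb_asym_scale[OF assms] show ?thesis by blast
qed

text \<open>Pairwise distinct germs make the dominant class a single term. Its nonzero coefficient
  is the limit of the quotient by \<open>g\<close>, which contradicts eventual vanishing.\<close>

lemma lincomb_distinct_nonzero:
  assumes "asym_scale G" "snd ` set xs \<subseteq> G" "xs \<noteq> []" "\<forall>(c, g)\<in>set xs. c \<noteq> 0"
    and "sorted_wrt (\<lambda>(_, f) (_, g). \<not> germ_eq f g) xs"
  shows "\<not> (\<forall>\<^sub>F x in at_top. lincomb xs x = 0)"
proof
  assume ev: "\<forall>\<^sub>F x in at_top. lincomb xs x = 0"
  obtain g where g: "g \<in> snd ` set xs" "\<forall>f\<in>snd ` set xs. germ_eq f g \<or> germ_prec f g"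
    using asym_scale_max[OF assms(1-3)] by blast
  have lim: "filterlim g at_top at_top"
    using assms(1,2) g by (auto simp: asym_scale_def)
  have "(\<Sum>(c, f)\<leftarrow>xs. if germ_eq f g then c else 0) \<noteq> 0"
    using assms(4,5) g(1)
  proof (induction xs)
    case (Cons y ys)
    obtain c f where y: "y = (c, f)" by force
    show ?case
    proof (cases "germ_eq f g")
      case True
      have "(\<Sum>(c, f)\<leftarrow>ys. if germ_eq f g then c else 0) = (\<Sum>p\<leftarrow>ys. 0)"
      proof (intro arg_cong[where f = sum_list] map_cong refl)
        fix p assume "p \<in> set ys"
        then have "\<not> germ_eq f (snd p)"
          using Cons.prems y by (cases p) auto
        then have "\<not> germ_eq (snd p) g"
          using True germ_eq_trans germ_eq_sym by blast
        then show "(case p of (c, f) \<Rightarrow> if germ_eq f g then c else 0) = 0"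
          by (simp add: case_prod_beta)
      qed
      then show ?thesis using Cons.prems True y by simp
    next
      case False
      then have "g \<noteq> f" by auto
      with Cons False show ?thesis by (auto simp: y)
    qed
  qed simp
  moreover have "((\<lambda>x. lincomb xs x / g x) \<longlongrightarrow> 0) at_top"
    by (rule Lim_transform_eventually[of "\<lambda>_. 0"]) (use ev in \<open>auto elim: eventually_mono\<close>)
  ultimately show False
    using lincomb_div_dominant[OF g(2) lim] tendsto_unique[OF trivial_limit_at_top_linorder] by blast
qed


section \<open>Comparability of log-exp monomials\<close>

lemma iter_log_0 [simp]: "iter_log 0 x = x"
  and iter_log_Suc: "iter_log (Suc j) x = ln (iter_log j x)"
  by (simp_all add: iter_log_def)

lemma filterlim_iter_log: "filterlim (iter_log j :: real \<Rightarrow> real) at_top at_top"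
proof (induction j)
  case 0
  then show ?case by (simp add: filterlim_ident)
next
  case (Suc j)
  then show ?case
    using filterlim_compose[OF ln_at_top Suc] by (simp add: iter_log_Suc[abs_def])
qed

lemma germ_prec_iter_log: "i < j \<Longrightarrow> germ_prec (iter_log j) (iter_log i)"
proof (induction j)
  case (Suc j)
  have step: "germ_prec (iter_log (Suc j)) (iter_log j)"
    using filterlim_compose[OF ln_x_over_x_tendsto_0 filterlim_iter_log[of j]]
    by (simp add: germ_prec_def iter_log_Suc)
  show ?case
  proof (cases "i = j")
    case False
    with Suc have "germ_prec (iter_log j) (iter_log i)" by simp
    with step show ?thesis
      using germ_prec_trans filterlim_iter_log by blast
  qed (use step in simp)
qed simp

lemma not_germ_eq_and_prec:
  assumes "germ_eq f g" "germ_prec f g" "filterlim g at_top at_top"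
  shows False
  using germ_eq_imp_div_tendsto_1[OF assms(1,3)] assms(2)
    tendsto_unique[OF trivial_limit_at_top_linorder] unfolding germ_prec_def
  by (metis zero_neq_one)

text \<open>Start of the induction on the height: logarithms of monomials of height 0 are
  combinations of iterated logarithms.\<close>

lemma asym_scale_iter_log: "asym_scale (range iter_log)"
  unfolding asym_scale_def
  by (auto simp: filterlim_iter_log) (metis germ_eq_refl germ_prec_iter_log linorder_neqE_nat)

section \<open>Logarithms of log-exp monomials as linear combinations\<close>

fun log_terms :: "lexp \<Rightarrow> (real \<times> (real \<Rightarrow> real)) list" where
  "log_terms (LExp \<Phi> \<alpha>) =
     map (\<lambda>(c, M). (c, lval M)) \<Phi> @ map (\<lambda>j. (\<alpha> ! j, iter_log (Suc j))) [0..<length \<alpha>]"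

lemma eventually_lval_eq_exp: "\<forall>\<^sub>F x in at_top. lval L x = exp (lincomb (log_terms L) x)"
proof (cases L)
  case (LExp \<Phi> \<alpha>)
  have "\<forall>\<^sub>F x in at_top. \<forall>j\<in>{..<length \<alpha>}. iter_log j x > (0::real)"
    by (intro eventually_ball_finite ballI finite_lessThan)
      (use filterlim_iter_log in \<open>auto simp: filterlim_at_top_dense\<close>)
  then show ?thesis
  proof eventually_elim
    case (elim x)
    \<comment> \<open>Taking logarithms turns a power of one iterated logarithm into a multiple of
      the next, whence \<open>Suc j\<close> in \<open>log_terms\<close>. Positivity of all factors
      restricts this to large \<open>x\<close>.\<close>
    have "(\<Prod>j<length \<alpha>. iter_log j x powr (\<alpha> ! j)) = exp (\<Sum>j<length \<alpha>. \<alpha> ! j * iter_log (Suc j) x)"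
      unfolding exp_sum[OF finite_lessThan]
    proof (intro prod.cong refl)
      fix j assume "j \<in> {..<length \<alpha>}"
      with elim have "iter_log j x > 0" by blast
      then show "iter_log j x powr (\<alpha> ! j) = exp (\<alpha> ! j * iter_log (Suc j) x)"
        by (simp add: powr_def iter_log_Suc)
    qed
    then show ?case
      by (simp add: LExp exp_add lincomb_def o_def case_prod_unfold interv_sum_list_conv_sum_set_nat
          lessThan_atLeast0)
  qed
qed

lemma eventually_lval_pos: "\<forall>\<^sub>F x in at_top. lval L x > 0"
  using eventually_lval_eq_exp[of L] by eventually_elim simp

lemma eventually_ln_lval: "\<forall>\<^sub>F x in at_top. ln (lval L x) = lincomb (log_terms L) x"
  using eventually_lval_eq_exp[of L] by eventually_elim simp

definition neg_terms :: "(real \<times> (real \<Rightarrow> real)) list \<Rightarrow> (real \<times> (real \<Rightarrow> real)) list" where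
  "neg_terms = map (\<lambda>(c, g). (- c, g))"

lemma lincomb_neg_terms [simp]: "lincomb (neg_terms xs) x = - lincomb xs x"
  by (induction xs) (auto simp: neg_terms_def)

lemma snd_set_neg_terms [simp]: "snd ` set (neg_terms xs) = snd ` set xs"
  by (force simp: neg_terms_def)

text \<open>Only three behaviours of the log-quotient \<open>D\<close> are possible over a scale;
  vanishing, growth to +infinity and decrease to -infinity yield the three alternatives.\<close>

lemma lval_trichotomy:
  assumes "asym_scale G" "snd ` set (log_terms L) \<subseteq> G" "snd ` set (log_terms L') \<subseteq> G"
  shows "germ_eq (lval L) (lval L') \<or> germ_prec (lval L) (lval L') \<or> germ_prec (lval L') (lval L)"
proof -
  define D where "D = lincomb (log_terms L @ neg_terms (log_terms L'))"
  have eq: "\<forall>\<^sub>F x in at_top. lval L x = exp (D x) * lval L' x \<and> lval L x / lval L' x = exp (D x) \<and>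
      lval L' x / lval L x = exp (- D x)"
    using eventually_lval_eq_exp[of L] eventually_lval_eq_exp[of L']
    by eventually_elim (simp add: D_def flip: exp_add exp_diff)
  consider "\<forall>\<^sub>F x in at_top. D x = 0" | "filterlim D at_top at_top" | "filterlim D at_bot at_top"
  proof -
    have "snd ` set (log_terms L @ neg_terms (log_terms L')) \<subseteq> G"
      using assms(2,3) by (simp add: image_Un)
    from lincomb_asym_scale_limit[OF assms(1) this, folded D_def] show thesis
      by (elim disjE) (fact that)+
  qed
  then show ?thesis
  proof cases
    case 1
    with eq have "germ_eq (lval L) (lval L')"
      unfolding germ_eq_def by eventually_elim (metis exp_zero mult_1)
    then show ?thesis ..
  next
    case 2
    then have "((\<lambda>x. exp (- D x)) \<longlongrightarrow> 0) at_top"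
      by (intro filterlim_compose[OF exp_at_bot] filterlim_compose[OF filterlim_uminus_at_bot_at_top])
    then have "((\<lambda>x. lval L' x / lval L x) \<longlongrightarrow> 0) at_top"
      by (rule Lim_transform_eventually) (use eq in \<open>auto elim: eventually_mono\<close>)
    then show ?thesis by (simp add: germ_prec_def)
  next
    case 3
    then have "((\<lambda>x. exp (D x)) \<longlongrightarrow> 0) at_top"
      by (intro filterlim_compose[OF exp_at_bot])
    then have "((\<lambda>x. lval L x / lval L' x) \<longlongrightarrow> 0) at_top"
      by (rule Lim_transform_eventually) (use eq in \<open>auto elim: eventually_mono\<close>)
    then show ?thesis by (simp add: germ_prec_def)
  qed
qed

section \<open>Comparability by induction on the height\<close>

definition large_germs :: "lexp set \<Rightarrow> (real \<Rightarrow> real) set" where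
  "large_germs S = {g. filterlim g at_top at_top \<and> (\<exists>M\<in>S. germ_eq g (lval M))}"

lemma large_germs_mono: "S \<subseteq> T \<Longrightarrow> large_germs S \<subseteq> large_germs T"
  by (auto simp: large_germs_def)

lemma reduced_exponent_mono: "reduced_exponent S \<Phi> \<Longrightarrow> S \<subseteq> T \<Longrightarrow> reduced_exponent T \<Phi>"
  unfolding reduced_exponent_def by fast

lemma logexp_upto_mono: "h \<le> k \<Longrightarrow> logexp_upto h \<subseteq> logexp_upto k"
  by (rule lift_Suc_mono_le) auto

lemma LExp_Nil_logexp_upto: "LExp [] \<alpha> \<in> logexp_upto h"
  using logexp_upto_mono[of 0 h] by auto

lemma logexp_upto_reduced:
  "LExp \<Phi> \<alpha> \<in> logexp_upto h \<Longrightarrow> reduced_exponent (logexp_upto h) \<Phi>"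
proof (induction h)
  case 0
  then show ?case by (simp add: reduced_exponent_def)
next
  case (Suc h)
  then show ?case
    by (auto intro: reduced_exponent_mono)
qed

text \<open>Membership in \<open>large_germs\<close> is up to germ equality, so that
  \<open>iter_log j\<close> belongs although it agrees with an \<open>lval\<close> only for large
  arguments.\<close>

lemma iter_log_in_large_germs: "iter_log j \<in> large_germs (logexp_upto h)"
proof -
  define L where "L = LExp [] (replicate j 0 @ [1])"
  have "\<forall>\<^sub>F x in at_top. \<forall>i\<in>{..j}. iter_log i x > (0::real)"
    by (intro eventually_ball_finite ballI finite_atMost)
      (use filterlim_iter_log in \<open>auto simp: filterlim_at_top_dense\<close>)
  then have "germ_eq (iter_log j) (lval L)"
    unfolding germ_eq_def
  proof eventually_elim
    case (elim x)
    \<comment> \<open>A factor with exponent 0 equals 1 only at a nonzero base, as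
      \<open>0 powr 0 = 0\<close>.\<close>
    have "(\<Prod>i<j. iter_log i x powr ((replicate j 0 @ [1]) ! i)) = (1::real)"
    proof (intro prod.neutral ballI)
      fix i assume i: "i \<in> {..<j}"
      with elim have "iter_log i x > 0" by simp
      with i show "iter_log i x powr ((replicate j 0 @ [1]) ! i) = (1::real)"
        by (simp add: nth_append)
    qed
    moreover have "iter_log j x > 0" using elim by simp
    ultimately show ?case
      by (simp add: L_def nth_append)
  qed
  then show ?thesis
    using filterlim_iter_log LExp_Nil_logexp_upto unfolding L_def large_germs_def by blast
qed

text \<open>Taking logarithms lowers the height by one; this descent drives the induction.\<close>

lemma log_terms_large_germs:
  assumes "L \<in> logexp_upto (Suc h)"
  shows "snd ` set (log_terms L) \<subseteq> large_germs (logexp_upto h)"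
proof (cases L)
  case (LExp \<Phi> \<alpha>)
  with assms have "reduced_exponent (logexp_upto h) \<Phi>"
    using logexp_upto_reduced by auto
  then have "lval M \<in> large_germs (logexp_upto h)" if "(c, M) \<in> set \<Phi>" for c M
    using that germ_eq_refl unfolding reduced_exponent_def large_germs_def by blast
  then show ?thesis
    using iter_log_in_large_germs by (auto simp: LExp)
qed

lemma asym_scale_large_germs:
  assumes "\<And>L L'. L \<in> S \<Longrightarrow> L' \<in> S \<Longrightarrow>
    germ_eq (lval L) (lval L') \<or> germ_prec (lval L) (lval L') \<or> germ_prec (lval L') (lval L)"
  shows "asym_scale (large_germs S)"
  unfolding asym_scale_def
proof (intro conjI ballI)
  fix f g assume "f \<in> large_germs S" "g \<in> large_germs S"
  then obtain L L' where L: "L \<in> S" "L' \<in> S" "germ_eq f (lval L)" "germ_eq g (lval L')"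
    by (auto simp: large_germs_def)
  with assms[OF L(1,2)] show "germ_eq f g \<or> germ_prec f g \<or> germ_prec g f"
    using germ_prec_cong[OF L(3,4)] germ_prec_cong[OF L(4,3)]
    by (meson germ_eq_sym germ_eq_trans)
qed (simp add: large_germs_def)

text \<open>Two monomials are compared through their logarithms, which are combinations over the
  scale one height below.\<close>

lemma asym_scale_logexp_upto: "asym_scale (large_germs (logexp_upto h))"
proof (induction h)
  case 0
  show ?case
  proof (rule asym_scale_large_germs, rule lval_trichotomy[OF asym_scale_iter_log])
    fix L assume "L \<in> logexp_upto 0"
    then obtain \<alpha> where "L = LExp [] \<alpha>" by auto
    then show "snd ` set (log_terms L) \<subseteq> range iter_log" by auto
    then show "snd ` set (log_terms L) \<subseteq> range iter_log" .
  qed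
next
  case (Suc h)
  show ?case
    by (rule asym_scale_large_germs, rule lval_trichotomy[OF Suc]; erule log_terms_large_germs)
qed

text \<open>A positive common height, as \<open>log_terms_large_germs\<close> requires a
  successor.\<close>

lemma logexp_common_height:
  assumes "L \<in> logexp" "L' \<in> logexp"
  obtains h where "L \<in> logexp_upto (Suc h)" "L' \<in> logexp_upto (Suc h)"
proof -
  obtain h k where hk: "L \<in> logexp_upto h" "L' \<in> logexp_upto k"
    using assms by (auto simp: logexp_def)
  have "h \<le> Suc (max h k)" "k \<le> Suc (max h k)" by auto
  note this[THEN logexp_upto_mono]
  with hk show thesis using that[of "max h k"] by (meson subsetD)
qed

lemma asym_scale_logexp: "asym_scale (large_germs logexp)"
proof (rule asym_scale_large_germs)
  fix L L' assume "L \<in> logexp" "L' \<in> logexp"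
  then obtain h where "L \<in> logexp_upto (Suc h)" "L' \<in> logexp_upto (Suc h)"
    using logexp_common_height by blast
  then show "germ_eq (lval L) (lval L') \<or> germ_prec (lval L) (lval L') \<or> germ_prec (lval L') (lval L)"
    by (rule lval_trichotomy[OF asym_scale_logexp_upto[of h] log_terms_large_germs log_terms_large_germs])
qed

lemma logexp_upto_subset: "logexp_upto h \<subseteq> logexp"
  unfolding logexp_def by (rule UN_upper) simp

lemma log_terms_logexp:
  assumes "L \<in> logexp"
  shows "snd ` set (log_terms L) \<subseteq> large_germs logexp"
proof -
  obtain h where "L \<in> logexp_upto (Suc h)"
    using logexp_common_height[OF assms assms] by blast
  then have "snd ` set (log_terms L) \<subseteq> large_germs (logexp_upto h)"
    by (rule log_terms_large_germs)
  also have "\<dots> \<subseteq> large_germs logexp"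
    by (rule large_germs_mono[OF logexp_upto_subset])
  finally show ?thesis .
qed

lemma LExp_Nil_logexp [simp]: "LExp [] \<alpha> \<in> logexp"
  by (rule subsetD[OF logexp_upto_subset LExp_Nil_logexp_upto])

lemma iter_log_logexp: "iter_log j \<in> large_germs logexp"
  by (rule subsetD[OF large_germs_mono[OF logexp_upto_subset] iter_log_in_large_germs])

section \<open>Expressions of the germ 1\<close>

lemma lincomb_filter_nonzero: "lincomb (filter (\<lambda>(c, _). c \<noteq> 0) xs) x = lincomb xs x"
  by (induction xs) (auto simp: lincomb_def)

text \<open>The logarithm vanishes eventually, so no term can be present once the germs are
  distinct. The monomials of a reduced exponent are distinct and are no \<open>iter_log j\<close>
  with j >= 1, while the powers contribute only such germs.\<close>

lemma logexp_eventually_1: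
  assumes "LExp \<Phi> \<alpha> \<in> logexp" "\<forall>\<^sub>F x in at_top. lval (LExp \<Phi> \<alpha>) x = 1"
  shows "\<Phi> = []" "\<forall>j<length \<alpha>. \<alpha> ! j = 0"
proof -
  define xs where "xs = map (\<lambda>(c, M). (c, lval M)) \<Phi>"
  \<comment> \<open>Exponents 0 are legal in an expression and have to be discarded before all
    coefficients are nonzero.\<close>
  define js where "js = filter (\<lambda>j. \<alpha> ! j \<noteq> 0) [0..<length \<alpha>]"
  define ys :: "(real \<times> (real \<Rightarrow> real)) list" where "ys = map (\<lambda>j. (\<alpha> ! j, iter_log (Suc j))) js"
  have "reduced_exponent logexp \<Phi>"
  proof -
    from assms(1) obtain h where "LExp \<Phi> \<alpha> \<in> logexp_upto h"
      unfolding logexp_def by blast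
    from reduced_exponent_mono[OF logexp_upto_reduced[OF this] logexp_upto_subset] show ?thesis .
  qed
  then have red: "\<And>c M. (c, M) \<in> set \<Phi> \<Longrightarrow> c \<noteq> 0 \<and> M \<in> logexp \<and> filterlim (lval M) at_top at_top \<and>
        (\<forall>j\<ge>1. \<not> germ_eq (lval M) (iter_log j))"
     "sorted_wrt (\<lambda>(_, M) (_, M'). \<not> germ_eq (lval M) (lval M')) \<Phi>"
    by (auto simp: reduced_exponent_def)
  have eq: "filter (\<lambda>(c, _). c \<noteq> 0) (log_terms (LExp \<Phi> \<alpha>)) = xs @ ys"
  proof -
    have "filter (\<lambda>(c, _). c \<noteq> 0) xs = xs"
      using red(1) by (auto simp: xs_def filter_id_conv)
    then show ?thesis
      unfolding xs_def[symmetric] log_terms.simps filter_append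
      by (simp add: ys_def js_def filter_map o_def)
  qed
  have sub: "snd ` set (xs @ ys) \<subseteq> large_germs logexp"
    using log_terms_logexp[OF assms(1)] unfolding eq[symmetric] by auto
  have "\<forall>\<^sub>F x in at_top. lincomb (xs @ ys) x = 0"
    using assms(2) eventually_lval_eq_exp[of "LExp \<Phi> \<alpha>"]
    unfolding eq[symmetric] lincomb_filter_nonzero
    by eventually_elim (simp del: lval.simps log_terms.simps)
  moreover have "\<forall>(c, g)\<in>set (xs @ ys). c \<noteq> 0"
    unfolding eq[symmetric] by auto
  moreover have "sorted_wrt (\<lambda>(_, f) (_, g). \<not> germ_eq f g) (xs @ ys)"
    unfolding sorted_wrt_append
  proof (intro conjI)
    show "sorted_wrt (\<lambda>(_, f) (_, g). \<not> germ_eq f g) xs"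
      using red(2) by (simp add: xs_def sorted_wrt_map case_prod_unfold)
    have "sorted_wrt (<) js"
      by (simp add: js_def sorted_wrt_filter)
    then have "sorted_wrt (\<lambda>i j. \<not> germ_eq (iter_log (Suc i) :: real \<Rightarrow> real) (iter_log (Suc j))) js"
    proof (rule sorted_wrt_mono_rel[rotated])
      fix i j :: nat assume "i < j"
      then have "germ_prec (iter_log (Suc j)) (iter_log (Suc i))"
        by (intro germ_prec_iter_log) simp
      then show "\<not> germ_eq (iter_log (Suc i) :: real \<Rightarrow> real) (iter_log (Suc j))"
        using not_germ_eq_and_prec filterlim_iter_log germ_eq_sym by blast
    qed
    then show "sorted_wrt (\<lambda>(_, f) (_, g). \<not> germ_eq f g) ys"
      by (simp add: ys_def sorted_wrt_map)
    show "\<forall>p\<in>set xs. \<forall>q\<in>set ys. (case p of (_, f) \<Rightarrow> \<lambda>(_, g). \<not> germ_eq f g) q"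
    proof (intro ballI)
      fix p q assume "p \<in> set xs" "q \<in> set ys"
      then obtain c M j where "(c, M) \<in> set \<Phi>" "p = (c, lval M)" "q = (\<alpha> ! j, iter_log (Suc j))"
        by (auto simp: xs_def ys_def)
      with red(1)[of c M] show "(case p of (_, f) \<Rightarrow> \<lambda>(_, g). \<not> germ_eq f g) q"
        by auto
    qed
  qed
  ultimately have "xs @ ys = []"
    using lincomb_distinct_nonzero[OF asym_scale_logexp sub] by metis
  then have "\<Phi> = []" "js = []" by (simp_all add: xs_def ys_def)
  then show "\<Phi> = []" "\<forall>j<length \<alpha>. \<alpha> ! j = 0" by (simp_all add: js_def filter_empty_conv)
qed

text \<open>The principal logarithm has real part \<open>ln (norm z)\<close>, which is at least
  \<open>ln (Re z)\<close> for positive \<open>Re z\<close>; real part \<open>exp K\<close> one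
  level below therefore suffices.\<close>

lemma Re_iter_log_ge: "\<exists>x0. \<forall>z. Re z \<ge> x0 \<longrightarrow> Re (iter_log j z) \<ge> K"
proof (induction j arbitrary: K)
  case (Suc j)
  obtain x0 where x0: "\<And>z. Re z \<ge> x0 \<Longrightarrow> Re (iter_log j z) \<ge> exp K"
    using Suc.IH by blast
  have "Re (iter_log (Suc j) z) \<ge> K" if "Re z \<ge> x0" for z
  proof -
    have *: "exp K \<le> norm (iter_log j z)"
      using x0[OF that] complex_Re_le_cmod[of "iter_log j z"] by linarith
    then have "iter_log j z \<noteq> 0"
      by (auto simp flip: not_less)
    with * show ?thesis
      by (simp add: iter_log_Suc ln_ge_iff)
  qed
  then show ?case by (intro exI[of _ x0]) simp
qed auto

text \<open>Only factors with exponent 0 remain. They equal 1 wherever the iterated logarithm is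
  nonzero, which holds to the right of a common abscissa.\<close>

lemma lcont_logexp_eventually_1:
  assumes "L \<in> logexp" "\<forall>\<^sub>F x in at_top. lval L x = 1"
  shows "\<exists>x0. \<forall>z. Re z \<ge> x0 \<longrightarrow> lcont L z = 1"
proof (cases L)
  case (LExp \<Phi> \<alpha>)
  have L: "\<Phi> = []" "\<And>j. j < length \<alpha> \<Longrightarrow> \<alpha> ! j = 0"
    using logexp_eventually_1[OF assms[unfolded LExp]] by simp_all
  have "\<forall>j. \<exists>x0. \<forall>z. Re z \<ge> x0 \<longrightarrow> Re (iter_log j z) \<ge> 1"
    by (intro allI Re_iter_log_ge)
  then have "\<exists>x0. \<forall>j z. Re z \<ge> x0 j \<longrightarrow> Re (iter_log j z) \<ge> 1"
    by (rule choice)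
  then obtain x0 where "\<forall>j z. Re z \<ge> x0 j \<longrightarrow> Re (iter_log j z) \<ge> 1" ..
  then have x0: "Re (iter_log j z) \<ge> 1" if "Re z \<ge> x0 j" for j z
    using that by simp
  define X where "X = (\<Sum>j<length \<alpha>. \<bar>x0 j\<bar>)"
  have "lcont L z = 1" if "Re z \<ge> X" for z
  proof -
    have "iter_log j z \<noteq> 0" if j: "j < length \<alpha>" for j
    proof -
      have "x0 j \<le> \<bar>x0 j\<bar>" by simp
      also have "\<dots> \<le> X" unfolding X_def using j by (intro member_le_sum) auto
      finally have "Re (iter_log j z) \<ge> 1" using \<open>Re z \<ge> X\<close> by (intro x0) simp
      then show ?thesis by auto
    qed
    with L(2) show ?thesis by (simp add: LExp L(1))
  qed
  then show ?thesis by (intro exI[of _ X]) simp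
qed


section \<open>Stirling's formula\<close>

text \<open>The logarithm of Euler's limit formula \<open>Gamma_series\<close>; \<open>z = 0\<close>
  is separate because Gamma has a pole there.\<close>

lemma Gamma_plus_of_nat_asymp:
  fixes z :: real
  assumes "z \<ge> 0"
  shows "(\<lambda>n. ln (Gamma (real n + z + 1)) - ln (fact n) - z * ln (real n)) \<longlonglongrightarrow> 0"
proof (cases "z = 0")
  case True
  then show ?thesis by (simp add: Gamma_fact add.commute[of _ 1])
next
  case False
  with assms have z: "z > 0" by simp
  then have nz: "z \<notin> \<int>\<^sub>\<le>\<^sub>0" by (auto elim!: nonpos_Ints_cases)
  have Gz: "Gamma z > 0" using z by simp
  have "(\<lambda>n. ln (Gamma z) - ln (Gamma_series z n)) \<longlonglongrightarrow> ln (Gamma z) - ln (Gamma z)"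
    by (intro tendsto_intros Gamma_series_LIMSEQ) (use Gz in auto)
  moreover have "\<forall>\<^sub>F n in sequentially. ln (Gamma z) - ln (Gamma_series z n) =
      ln (Gamma (real n + z + 1)) - ln (fact n) - z * ln (real n)"
    using eventually_gt_at_top[of 0]
  proof eventually_elim
    case (elim n)
    have "Gamma_series z n = fact n * exp (z * ln (real n)) / (Gamma (real n + z + 1) / Gamma z)"
      unfolding Gamma_series_def by (simp add: pochhammer_Gamma[OF nz] add_ac)
    moreover have "Gamma (real n + z + 1) > 0" using z by (intro Gamma_real_pos) simp
    ultimately show ?case
      using Gz by (simp add: ln_mult ln_div)
  qed
  ultimately show ?thesis by (simp add: tendsto_cong)
qed

text \<open>The differences between the logarithm and its Taylor polynomials have, up to sign, the
  nonnegative derivatives \<open>t^2 / (1 + t)\<close> and \<open>t^3 / (1 + t)\<close>.\<close>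

lemma ln_one_plus_cubic_bounds:
  fixes y :: real
  assumes "y \<ge> 0"
  shows "y - y\<^sup>2 / 2 \<le> ln (1 + y)" "ln (1 + y) \<le> y - y\<^sup>2 / 2 + y ^ 3 / 3"
proof -
  have "ln (1 + 0) - 0 + 0\<^sup>2 / 2 \<le> ln (1 + y) - y + y\<^sup>2 / 2"
  proof (rule DERIV_nonneg_imp_nondecreasing[OF assms])
    fix t :: real assume t: "0 \<le> t" "t \<le> y"
    have "((\<lambda>t. ln (1 + t) - t + t\<^sup>2 / 2) has_real_derivative t\<^sup>2 / (1 + t)) (at t)"
      using t by (auto intro!: derivative_eq_intros simp: field_simps power2_eq_square)
    then show "\<exists>d. ((\<lambda>t. ln (1 + t) - t + t\<^sup>2 / 2) has_real_derivative d) (at t) \<and> 0 \<le> d"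
      using t by (intro exI[of _ "t\<^sup>2 / (1 + t)"]) auto
  qed
  then show "y - y\<^sup>2 / 2 \<le> ln (1 + y)" by simp
  have "0 - 0\<^sup>2 / 2 + 0 ^ 3 / 3 - ln (1 + 0) \<le> y - y\<^sup>2 / 2 + y ^ 3 / 3 - ln (1 + y)"
  proof (rule DERIV_nonneg_imp_nondecreasing[OF assms])
    fix t :: real assume t: "0 \<le> t" "t \<le> y"
    have "((\<lambda>t. t - t\<^sup>2 / 2 + t ^ 3 / 3 - ln (1 + t)) has_real_derivative t ^ 3 / (1 + t)) (at t)"
      using t by (auto intro!: derivative_eq_intros simp: field_simps power2_eq_square power3_eq_cube)
    then show "\<exists>d. ((\<lambda>t. t - t\<^sup>2 / 2 + t ^ 3 / 3 - ln (1 + t)) has_real_derivative d) (at t) \<and> 0 \<le> d"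
      using t by (intro exI[of _ "t ^ 3 / (1 + t)"]) auto
  qed
  then show "ln (1 + y) \<le> y - y\<^sup>2 / 2 + y ^ 3 / 3" by simp
qed

definition stirling_error :: "real \<Rightarrow> real" where
  "stirling_error x = ln (Gamma (x + 1)) - (x + 1 / 2) * ln x + x"

text \<open>The factor \<open>x + 1 / 2\<close> makes the terms of order \<open>1 / x\<close>
  cancel, leaving order \<open>1 / x^2\<close>. The bound is a difference so that it telescopes over
  unit steps.\<close>

lemma stirling_error_step:
  assumes "x \<ge> 1"
  shows "\<bar>stirling_error x - stirling_error (x + 1)\<bar> \<le> 2 / x - 2 / (x + 1)"
proof -
  have "Gamma (x + 1 + 1) = (x + 1) * Gamma (x + 1)"
    using assms by (intro Gamma_plus1) (auto elim!: nonpos_Ints_cases)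
  moreover have "Gamma (x + 1) > 0" using assms by simp
  ultimately have "ln (Gamma (x + 1 + 1)) = ln (x + 1) + ln (Gamma (x + 1))"
  proof -
    have "0 < x + 1" using assms by simp
    then show ?thesis
      using \<open>Gamma (x + 1 + 1) = (x + 1) * Gamma (x + 1)\<close> \<open>Gamma (x + 1) > 0\<close>
      by (simp only: ln_mult_pos)
  qed
  then have "stirling_error x - stirling_error (x + 1) = (x + 1 / 2) * (ln (x + 1) - ln x) - 1"
    unfolding stirling_error_def by (simp add: field_simps)
  moreover have "1 + 1 / x = (x + 1) / x"
    using assms by (simp add: field_simps)
  then have "ln (x + 1) - ln x = ln (1 + 1 / x)"
    using assms by (simp add: ln_div)
  ultimately have eq: "stirling_error x - stirling_error (x + 1) = (x + 1 / 2) * ln (1 + 1 / x) - 1" by simp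
  have up: "ln (1 + 1 / x) \<le> 1 / x - (1 / x)\<^sup>2 / 2 + (1 / x) ^ 3 / 3"
    and low: "ln (1 + 1 / x) \<ge> 1 / x - (1 / x)\<^sup>2 / 2"
    using ln_one_plus_cubic_bounds[of "1 / x"] assms by simp_all
  have xp: "x + 1 / 2 \<ge> 0" using assms by simp
  have "(x + 1 / 2) * (1 / x - (1 / x)\<^sup>2 / 2) - 1 = - (1 / (4 * x\<^sup>2))"
    using assms by (simp add: field_simps power2_eq_square)
  also have "\<dots> \<ge> - (1 / x\<^sup>2)" using assms by (simp add: field_simps)
  finally have "(x + 1 / 2) * ln (1 + 1 / x) - 1 \<ge> - (1 / x\<^sup>2)"
    using mult_left_mono[OF low xp] by linarith
  moreover have "(x + 1 / 2) * (1 / x - (1 / x)\<^sup>2 / 2 + (1 / x) ^ 3 / 3) - 1 = 1 / (12 * x\<^sup>2) + 1 / (6 * x ^ 3)"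
    using assms by (simp add: field_simps power2_eq_square power3_eq_cube)
  moreover have "1 / (6 * x ^ 3) \<le> 1 / (6 * x\<^sup>2)"
    using assms by (simp add: field_simps power2_eq_square power3_eq_cube)
  moreover have "1 / (12 * x\<^sup>2) + 1 / (6 * x\<^sup>2) \<le> 1 / x\<^sup>2"
    using assms by (simp add: field_simps)
  ultimately have "\<bar>(x + 1 / 2) * ln (1 + 1 / x) - 1\<bar> \<le> 1 / x\<^sup>2"
    using mult_left_mono[OF up xp] by linarith
  also have "\<dots> = 2 / (2 * x\<^sup>2)" by simp
  also have "\<dots> \<le> 2 / (x * (x + 1))"
    using assms by (intro divide_left_mono) (auto simp: power2_eq_square)
  also have "\<dots> = 2 / x - 2 / (x + 1)"
    using assms by (simp add: field_simps)
  finally show ?thesis unfolding eq .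
qed

lemma stirling_error_shift:
  assumes "x \<ge> 1"
  shows "\<bar>stirling_error x - stirling_error (real n + x)\<bar> \<le> 2 / x - 2 / (real n + x)"
proof (induction n)
  case (Suc n)
  show ?case
    using Suc stirling_error_step[of "real n + x"] assms by (simp add: add_ac)
qed simp

lemma stirling_error_periodic:
  assumes "z \<ge> 0"
  shows "(\<lambda>n. stirling_error (real n + z) - stirling_error (real n)) \<longlonglongrightarrow> 0"
proof -
  \<comment> \<open>What is left of the difference after splitting off the expression of
    \<open>Gamma_plus_of_nat_asymp\<close>.\<close>
  have "(\<lambda>n. (real n + z + 1 / 2) * (ln (real n) - ln (real n + z)) + z) \<longlonglongrightarrow> 0"
    by real_asymp
  from tendsto_add_zero[OF Gamma_plus_of_nat_asymp[OF assms] this]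
  show ?thesis
    by (rule Lim_transform_eventually)
      (auto simp: stirling_error_def Gamma_fact add.commute[of _ 1] algebra_simps)
qed

text \<open>\<open>stirling_error\<close> is within \<open>2 / x\<close> of its limit along \<open>x + \<nat>\<close>, and that limit does not
  depend on \<open>x\<close>.\<close>

lemma stirling_error_diff:
  assumes "x \<ge> 1" "y \<ge> 1"
  shows "\<bar>stirling_error x - stirling_error y\<bar> \<le> 2 / x + 2 / y"
proof (rule LIMSEQ_le_const)
  show "(\<lambda>n. 2 / x + 2 / y + (\<bar>stirling_error (real n + x) - stirling_error (real n)\<bar>
      + \<bar>stirling_error (real n + y) - stirling_error (real n)\<bar>)) \<longlonglongrightarrow> 2 / x + 2 / y"
    using tendsto_add[OF tendsto_const tendsto_add_zero[OF
      tendsto_rabs_zero[OF stirling_error_periodic] tendsto_rabs_zero[OF stirling_error_periodic]]] assms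
    by force
  show "\<exists>N. \<forall>n\<ge>N. \<bar>stirling_error x - stirling_error y\<bar> \<le>
      2 / x + 2 / y + (\<bar>stirling_error (real n + x) - stirling_error (real n)\<bar>
      + \<bar>stirling_error (real n + y) - stirling_error (real n)\<bar>)"
  proof (intro exI[of _ 0] allI impI)
    fix n
    have "2 / (real n + x) \<ge> 0" "2 / (real n + y) \<ge> 0" using assms by auto
    then show "\<bar>stirling_error x - stirling_error y\<bar> \<le>
      2 / x + 2 / y + (\<bar>stirling_error (real n + x) - stirling_error (real n)\<bar>
      + \<bar>stirling_error (real n + y) - stirling_error (real n)\<bar>)"
      using stirling_error_shift[OF assms(1), of n] stirling_error_shift[OF assms(2), of n]
      by linarith
  qed
qed

text \<open>\<open>stirling_error_diff\<close> makes the integer values Cauchy and then, with the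
  second argument tending to infinity, transfers their limit to real arguments.\<close>

lemma stirling_error_convergent: "\<exists>l. (stirling_error \<longlongrightarrow> l) at_top"
proof -
  have "Cauchy (\<lambda>n. stirling_error (real (Suc n)))"
  proof (rule metric_CauchyI)
    fix e :: real assume e: "e > 0"
    obtain M where M: "4 / e < real M" using reals_Archimedean2 by blast
    have "dist (stirling_error (real (Suc m))) (stirling_error (real (Suc n))) < e"
      if "m \<ge> M" "n \<ge> M" for m n
    proof -
      have "2 / real (Suc k) < e / 2" if "k \<ge> M" for k
      proof -
        have "4 / e < real (Suc k)" using M that by linarith
        with e show ?thesis by (simp add: field_simps)
      qed
      with that stirling_error_diff[of "real (Suc m)" "real (Suc n)"] show ?thesis
        unfolding dist_real_def by (smt (verit) field_sum_of_halves of_nat_0_le_iff of_nat_Suc)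
    qed
    then show "\<exists>M. \<forall>m\<ge>M. \<forall>n\<ge>M. dist (stirling_error (real (Suc m))) (stirling_error (real (Suc n))) < e"
      by blast
  qed
  then obtain l where l: "(\<lambda>n. stirling_error (real (Suc n))) \<longlonglongrightarrow> l"
    using real_Cauchy_convergent convergent_def by blast
  have "norm (stirling_error x - l) \<le> 2 / x" if "x \<ge> 1" for x
  proof (rule LIMSEQ_le)
    show "(\<lambda>n. norm (stirling_error x - stirling_error (real (Suc n)))) \<longlonglongrightarrow> norm (stirling_error x - l)"
      by (intro tendsto_intros l)
    show "(\<lambda>n. 2 / x + 2 / real (Suc n)) \<longlonglongrightarrow> 2 / x"
      by real_asymp
    show "\<exists>N. \<forall>n\<ge>N. norm (stirling_error x - stirling_error (real (Suc n))) \<le> 2 / x + 2 / real (Suc n)"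
      using stirling_error_diff[OF that] by auto
  qed
  then have "\<forall>\<^sub>F x in at_top. norm (stirling_error x - l) \<le> 2 / x"
    by (auto simp: eventually_at_top_linorder)
  moreover have "((\<lambda>x::real. 2 / x) \<longlongrightarrow> 0) at_top" by real_asymp
  ultimately have "((\<lambda>x. stirling_error x - l) \<longlongrightarrow> 0) at_top"
    by (rule Lim_null_comparison)
  then show ?thesis using LIM_zero_cancel by blast
qed


section \<open>Monomials asymptotic to a multiple of a gamma monomial\<close>

definition const_1 :: lexp where "const_1 = LExp [] []"

lemma lval_const_1 [simp]: "lval const_1 x = 1"
  and lcont_const_1 [simp]: "lcont const_1 z = 1"
  by (simp_all add: const_1_def)

lemma const_1_logexp_lt_x [simp]: "const_1 \<in> logexp_lt_x"
  by (simp add: logexp_lt_x_def const_1_def)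

lemma x_ln_x_large_germs: "(\<lambda>x. x * ln x) \<in> large_germs logexp"
proof -
  have "\<forall>\<^sub>F x::real in at_top. x * ln x = lval (LExp [] [1, 1]) x"
    using eventually_gt_at_top[of 1]
    by eventually_elim (simp add: iter_log_Suc lessThan_Suc numeral_2_eq_2)
  moreover have "filterlim (\<lambda>x::real. x * ln x) at_top at_top"
    by real_asymp
  ultimately show ?thesis
    unfolding large_germs_def germ_eq_def using LExp_Nil_logexp by blast
qed

text \<open>For \<open>Gamma_Type\<close> the terms come from Stirling's formula, up to a constant factor.\<close>

fun glog_terms :: "gmon \<Rightarrow> (real \<times> (real \<Rightarrow> real)) list" where
  "glog_terms (Pure_LE L) = log_terms L"
| "glog_terms (Gamma_Type l H \<kappa>) = log_terms H @
     [(\<kappa>, \<lambda>x. x * ln x), (l + \<kappa> * ln \<kappa> - \<kappa>, iter_log 0), (1 / 2, iter_log (Suc 0))]"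

lemma glog_terms_large_germs:
  assumes "growth_monomial M"
  shows "snd ` set (glog_terms M) \<subseteq> large_germs logexp"
  using assms log_terms_logexp x_ln_x_large_germs iter_log_logexp
  by (cases M) (auto simp: logexp_lt_x_def simp del: log_terms.simps)

lemma eventually_gval_pos:
  assumes "growth_monomial M"
  shows "\<forall>\<^sub>F x in at_top. gval M x > 0"
proof (cases M)
  case (Pure_LE L)
  then show ?thesis using eventually_lval_pos[of L] by simp
next
  case (Gamma_Type l H \<kappa>)
  with assms have "\<kappa> > 0" by simp
  show ?thesis
    using eventually_lval_pos[of H] eventually_ge_at_top[of 0]
  proof eventually_elim
    case (elim x)
    with \<open>\<kappa> > 0\<close> have "Gamma (\<kappa> * x + 1) > 0" by (intro Gamma_real_pos) (simp add: add_nonneg_pos)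
    with elim show ?case by (simp add: Gamma_Type del: lval.simps)
  qed
qed

lemma ln_gval_asymp:
  assumes "growth_monomial M"
  shows "\<exists>C. ((\<lambda>x. ln (gval M x) - lincomb (glog_terms M) x) \<longlongrightarrow> C) at_top"
proof (cases M)
  case (Pure_LE L)
  have "((\<lambda>x. ln (gval M x) - lincomb (glog_terms M) x) \<longlongrightarrow> 0) at_top"
    by (rule Lim_transform_eventually[of "\<lambda>_. 0"])
      (use eventually_ln_lval[of L] in \<open>auto simp: Pure_LE simp del: lval.simps log_terms.simps elim!: eventually_mono\<close>)
  then show ?thesis ..
next
  case (Gamma_Type l H \<kappa>)
  with assms have \<kappa>: "\<kappa> > 0" by simp
  obtain c where c: "(stirling_error \<longlongrightarrow> c) at_top"
    using stirling_error_convergent by blast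
  have "filterlim (\<lambda>x. \<kappa> * x) at_top at_top"
    by (intro filterlim_tendsto_pos_mult_at_top[OF tendsto_const \<kappa>] filterlim_ident)
  \<comment> \<open>Stirling at \<open>\<kappa> * x\<close> leaves the constant
    \<open>1 / 2 * ln \<kappa>\<close>, which does not tend to infinity and so cannot be among the
    terms.\<close>
  from tendsto_add[OF filterlim_compose[OF c this] tendsto_const]
  have "((\<lambda>x. stirling_error (\<kappa> * x) + 1 / 2 * ln \<kappa>) \<longlongrightarrow> c + 1 / 2 * ln \<kappa>) at_top" .
  moreover have "\<forall>\<^sub>F x in at_top. stirling_error (\<kappa> * x) + 1 / 2 * ln \<kappa> =
      ln (gval M x) - lincomb (glog_terms M) x"
    using eventually_ln_lval[of H] eventually_lval_pos[of H] eventually_gt_at_top[of 0]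
  proof eventually_elim
    case (elim x)
    with \<kappa> have "Gamma (\<kappa> * x + 1) > 0" by (intro Gamma_real_pos) (simp add: add_pos_pos)
    with elim have "ln (gval M x) = l * x + lincomb (log_terms H) x + ln (Gamma (\<kappa> * x + 1))"
      by (simp add: Gamma_Type ln_mult del: lval.simps log_terms.simps)
    with elim \<kappa> show ?case
      by (simp add: Gamma_Type stirling_error_def iter_log_Suc ln_mult algebra_simps del: lval.simps log_terms.simps)
  qed
  ultimately have "((\<lambda>x. ln (gval M x) - lincomb (glog_terms M) x) \<longlongrightarrow> c + 1 / 2 * ln \<kappa>) at_top"
    by (rule Lim_transform_eventually)
  then show ?thesis ..
qed

text \<open>Convergence along any \<open>p\<close> tending to infinity is enough, which covers the
  even and the odd integers. Once the log-terms agree, only the constants from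
  \<open>ln_gval_asymp\<close> separate the two monomials.\<close>

lemma tendsto_ln_gval_quotient:
  assumes "growth_monomial M" "growth_monomial M'"
    and p: "filterlim p at_top F" "F \<noteq> bot"
    and lim: "((\<lambda>n. gval M (p n) / gval M' (p n)) \<longlongrightarrow> c) F" "c > 0"
  shows "\<forall>\<^sub>F x in at_top. lincomb (glog_terms M @ neg_terms (glog_terms M')) x = 0"
    and "\<exists>C>0. ((\<lambda>x. gval M x / gval M' x) \<longlongrightarrow> C) at_top"
proof -
  define D where "D = lincomb (glog_terms M @ neg_terms (glog_terms M'))"
  obtain C1 C2 where C: "((\<lambda>x. ln (gval M x) - lincomb (glog_terms M) x) \<longlongrightarrow> C1) at_top"
    "((\<lambda>x. ln (gval M' x) - lincomb (glog_terms M') x) \<longlongrightarrow> C2) at_top"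
    using ln_gval_asymp assms(1,2) by blast
  have pos: "\<forall>\<^sub>F x in at_top. gval M x > 0 \<and> gval M' x > 0"
    using eventually_gval_pos[OF assms(1)] eventually_gval_pos[OF assms(2)] by eventually_elim simp
  have E: "((\<lambda>x. ln (gval M x / gval M' x) - D x) \<longlongrightarrow> C1 - C2) at_top"
    by (rule Lim_transform_eventually[OF tendsto_diff[OF C]])
      (use pos in eventually_elim, simp add: D_def ln_div)
  have "((\<lambda>n. ln (gval M (p n) / gval M' (p n)) - (ln (gval M (p n) / gval M' (p n)) - D (p n)))
      \<longlongrightarrow> ln c - (C1 - C2)) F"
    by (intro tendsto_diff tendsto_ln lim filterlim_compose[OF E p(1)]) (use lim in simp)
  then have Dp: "((\<lambda>n. D (p n)) \<longlongrightarrow> ln c - (C1 - C2)) F" by simp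
  have "\<not> filterlim D at_top at_top" "\<not> filterlim D at_bot at_top"
    using not_tendsto_and_filterlim_at_infinity[OF p(2) Dp]
      filterlim_compose[OF _ p(1), of D] filterlim_at_top_imp_at_infinity filterlim_at_bot_imp_at_infinity
    by blast+
  then show D0: "\<forall>\<^sub>F x in at_top. lincomb (glog_terms M @ neg_terms (glog_terms M')) x = 0"
    using lincomb_asym_scale_limit[OF asym_scale_logexp, of "glog_terms M @ neg_terms (glog_terms M')"]
      glog_terms_large_germs[OF assms(1)] glog_terms_large_germs[OF assms(2)]
    unfolding D_def[symmetric] by (simp add: image_Un del: lincomb_append)
  have "((\<lambda>x. exp (ln (gval M x / gval M' x) - D x)) \<longlongrightarrow> exp (C1 - C2)) at_top"
    by (intro tendsto_intros E)
  then have "((\<lambda>x. gval M x / gval M' x) \<longlongrightarrow> exp (C1 - C2)) at_top"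
    by (rule Lim_transform_eventually)
      (use pos D0[folded D_def] in eventually_elim, simp)
  then show "\<exists>C>0. ((\<lambda>x. gval M x / gval M' x) \<longlongrightarrow> C) at_top"
    by (intro exI[of _ "exp (C1 - C2)"]) simp
qed

text \<open>For a > 0 and \<open>H\<close> with germ 1 this is the germ
  \<open>a^x Gamma(x + 1)\<close>. \<open>H\<close> stays a parameter because different expressions
  of 1 are different monomials as data.\<close>

definition gamma_monomial :: "real \<Rightarrow> lexp \<Rightarrow> gmon" where
  "gamma_monomial a H = Gamma_Type (ln a) H 1"

lemma gval_gamma_monomial:
  "gval (gamma_monomial a H) x = exp (ln a * x) * lval H x * Gamma (x + 1)"
  by (simp add: gamma_monomial_def)

lemma growth_monomial_gamma_monomial [simp]: "growth_monomial (gamma_monomial a const_1)"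
  by (simp add: gamma_monomial_def)

text \<open>A pure log-exp monomial would be gamma-resonant. For a gamma monomial,
  \<open>ln H\<close> is forced to be a combination of \<open>x ln x\<close> and \<open>x\<close>,
  and \<open>ln H = o(x)\<close> kills both coefficients in turn.\<close>

lemma gamma_monomial_unique:
  assumes M: "growth_monomial M" and p: "filterlim p at_top F" "F \<noteq> bot"
    and lim: "((\<lambda>n. gval M (p n) / gval (gamma_monomial a const_1) (p n)) \<longlongrightarrow> c) F" "c > 0"
  shows "\<exists>H\<in>logexp. M = gamma_monomial a H \<and> (\<forall>\<^sub>F x in at_top. lval H x = 1)"
proof (cases M)
  case (Pure_LE L)
  obtain C where "C > 0" "((\<lambda>x. gval M x / gval (gamma_monomial a const_1) x) \<longlongrightarrow> C) at_top"
    using tendsto_ln_gval_quotient(2)[OF M _ p lim] by auto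
  then have "gamma_resonant L"
    unfolding gamma_resonant_def gamma_monomial_def Pure_LE gval.simps
    using const_1_logexp_lt_x zero_less_one by blast
  with M show ?thesis by (simp add: Pure_LE)
next
  case (Gamma_Type l H \<kappa>)
  with M have H: "H \<in> logexp" "\<kappa> > 0" "((\<lambda>x. ln (lval H x) / x) \<longlongrightarrow> 0) at_top"
    by (auto simp: logexp_lt_x_def simp del: lval.simps dest!: smalloD_tendsto)
  \<comment> \<open>The difference of the coefficients of \<open>x\<close> in the two lists; for
    \<open>gamma_monomial a const_1\<close> that coefficient is \<open>ln a - 1\<close>.\<close>
  define m where "m = l + \<kappa> * ln \<kappa> - \<kappa> - ln a + 1"
  have "\<forall>\<^sub>F x in at_top. lincomb (log_terms H) x = - ((\<kappa> - 1) * (x * ln x) + m * x)"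
    using tendsto_ln_gval_quotient(1)[OF M growth_monomial_gamma_monomial p lim]
    by (auto simp: Gamma_Type gamma_monomial_def const_1_def neg_terms_def m_def algebra_simps
        elim!: eventually_mono)
  with eventually_ln_lval[of H]
  have lnH: "\<forall>\<^sub>F x in at_top. ln (lval H x) = - ((\<kappa> - 1) * (x * ln x) + m * x)"
    by eventually_elim simp
  \<comment> \<open>Division by \<open>x * ln x\<close> isolates \<open>\<kappa> - 1\<close>;
    afterwards division by \<open>x\<close> isolates \<open>m\<close>.\<close>
  have "((\<lambda>x. (ln (lval H x) / x + m) / ln x) \<longlongrightarrow> 0) at_top"
    by (rule tendsto_divide_0[OF tendsto_add[OF H(3) tendsto_const]])
      (intro filterlim_at_top_imp_at_infinity ln_at_top)
  moreover have "\<forall>\<^sub>F x in at_top. (ln (lval H x) / x + m) / ln x = - (\<kappa> - 1)"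
    using lnH eventually_gt_at_top[of 1] by eventually_elim (simp add: field_simps)
  ultimately have "((\<lambda>x::real. - (\<kappa> - 1)) \<longlongrightarrow> 0) at_top"
    by (rule Lim_transform_eventually)
  then have \<kappa>: "\<kappa> = 1"
    by (simp add: tendsto_const_iff)
  have "\<forall>\<^sub>F x in at_top. ln (lval H x) / x = - m"
    using lnH eventually_gt_at_top[of 1] by eventually_elim (simp add: \<kappa> field_simps)
  with H(3) have "((\<lambda>x::real. - m) \<longlongrightarrow> 0) at_top"
    by (rule Lim_transform_eventually)
  then have m: "m = 0"
    by (simp add: tendsto_const_iff)
  have "\<forall>\<^sub>F x in at_top. lval H x = 1"
    using lnH eventually_lval_pos[of H] by eventually_elim (simp add: \<kappa> m)
  moreover have "l = ln a" using m by (simp add: m_def \<kappa>)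
  ultimately show ?thesis
    using H(1) by (auto simp: Gamma_Type gamma_monomial_def \<kappa>)
qed

section \<open>Uniqueness of the interpolant\<close>

lemma fval_Nil [simp]: "fval [] x = 0"
  and fval_Cons [simp]: "fval ((C, M) # xs) x = C * of_real (gval M x) + fval xs x"
  by (simp_all add: fval_def)

lemma fval_div_dominant:
  assumes "\<forall>(C', M')\<in>set xs. germ_prec (gval M') (gval M)" "growth_monomial M"
  shows "((\<lambda>x. fval ((C, M) # xs) x / of_real (gval M x)) \<longlongrightarrow> C) at_top"
proof -
  have "((\<lambda>x. fval xs x / of_real (gval M x)) \<longlongrightarrow> 0) at_top"
    using assms(1)
  proof (induction xs)
    case (Cons y ys)
    obtain C' M' where y: "y = (C', M')" by force
    have "((\<lambda>x. C' * of_real (gval M' x / gval M x) + fval ys x / of_real (gval M x))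
        \<longlongrightarrow> C' * of_real 0 + 0) at_top"
      using Cons by (intro tendsto_intros) (auto simp: y germ_prec_def)
    then show ?case by (simp add: y add_divide_distrib)
  qed simp
  then have "((\<lambda>x. C + fval xs x / of_real (gval M x)) \<longlongrightarrow> C + 0) at_top"
    by (intro tendsto_intros)
  moreover have "\<forall>\<^sub>F x in at_top. C + fval xs x / of_real (gval M x) =
      fval ((C, M) # xs) x / of_real (gval M x)"
    using eventually_gval_pos[OF assms(2)] by eventually_elim (simp add: add_divide_distrib)
  ultimately show ?thesis
    by (simp add: tendsto_cong)
qed

lemma fval_filter: "fval (filter (\<lambda>(C, _). C \<noteq> 0) xs) x = fval xs x"
  by (induction xs) (auto simp: fval_def)

text \<open>The leading term must be the gamma monomial, with coefficient 1; what remains vanishes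
  along \<open>p\<close>, which a further term with nonzero coefficient would prevent.\<close>

lemma fval_eq_gamma_monomial:
  assumes xs: "\<forall>(C, M)\<in>set xs. growth_monomial M"
      "sorted_wrt (\<lambda>(_, M) (_, M'). germ_prec (gval M') (gval M)) xs"
    and p: "filterlim p at_top F" "F \<noteq> bot"
    and eq: "\<forall>\<^sub>F n in F. fval xs (p n) = of_real (gval (gamma_monomial a const_1) (p n))"
  shows "\<exists>H\<in>logexp. filter (\<lambda>(C, _). C \<noteq> 0) xs = [(1, gamma_monomial a H)] \<and>
    (\<forall>\<^sub>F x in at_top. lval H x = 1)"
proof -
  define G where "G = gval (gamma_monomial a const_1)"
  define ys where "ys = filter (\<lambda>(C, _). C \<noteq> 0) xs"
  have Gpos: "\<forall>\<^sub>F n in F. G (p n) > 0"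
    using eventually_compose_filterlim[OF eventually_gval_pos p(1)] unfolding G_def by simp
  have eq': "\<forall>\<^sub>F n in F. fval ys (p n) = of_real (G (p n))"
    using eq by (simp add: ys_def fval_filter G_def)
  have "ys \<noteq> []"
  proof
    assume "ys = []"
    with eventually_happens'[OF p(2) eventually_conj[OF eq' Gpos]] show False by auto
  qed
  then obtain C M zs where ys: "ys = (C, M) # zs" by (metis list.exhaust surj_pair)
  have gm: "growth_monomial M'" "C' \<noteq> 0" if "(C', M') \<in> set ys" for C' M'
    using that xs(1) by (auto simp: ys_def)
  have sorted: "sorted_wrt (\<lambda>(_, M) (_, M'). germ_prec (gval M') (gval M)) ys"
    using xs(2) by (simp add: ys_def sorted_wrt_filter)
  have C: "C \<noteq> 0" and M: "growth_monomial M" using gm[of C M] by (simp_all add: ys)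
  have "((\<lambda>x. fval ys x / of_real (gval M x)) \<longlongrightarrow> C) at_top"
    unfolding ys using sorted M by (intro fval_div_dominant) (auto simp: ys)
  from filterlim_compose[OF this p(1)]
  have "((\<lambda>n. fval ys (p n) / of_real (gval M (p n))) \<longlongrightarrow> C) F" .
  moreover have "\<forall>\<^sub>F n in F. fval ys (p n) / of_real (gval M (p n)) = of_real (G (p n) / gval M (p n))"
    using eq' by eventually_elim simp
  ultimately have limC: "((\<lambda>n. of_real (G (p n) / gval M (p n))) \<longlongrightarrow> C) F"
    by (rule Lim_transform_eventually)
  have Mpos: "\<forall>\<^sub>F n in F. gval M (p n) > 0"
    using eventually_compose_filterlim[OF eventually_gval_pos[OF M] p(1)] .
  \<comment> \<open>\<open>gamma_monomial_unique\<close> needs a positive real limit, while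
    \<open>C\<close> is still an arbitrary nonzero complex number; hence moduli.\<close>
  have "((\<lambda>n. inverse (norm (of_real (G (p n) / gval M (p n)) :: complex))) \<longlongrightarrow> inverse (norm C)) F"
    by (intro tendsto_intros limC) (use C in simp)
  moreover have "\<forall>\<^sub>F n in F. inverse (norm (of_real (G (p n) / gval M (p n)) :: complex)) = gval M (p n) / G (p n)"
    using Mpos Gpos by eventually_elim (simp add: norm_divide divide_simps)
  ultimately have "((\<lambda>n. gval M (p n) / G (p n)) \<longlongrightarrow> inverse (norm C)) F"
    by (rule Lim_transform_eventually)
  from gamma_monomial_unique[OF M p this[unfolded G_def]] C
  obtain H where H: "H \<in> logexp" "M = gamma_monomial a H" "\<forall>\<^sub>F x in at_top. lval H x = 1"
    by auto
  have MG: "\<forall>\<^sub>F x in at_top. gval M x = G x"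
    using H(3) by eventually_elim (simp add: H(2) G_def gval_gamma_monomial del: lval.simps)
  have MGp: "\<forall>\<^sub>F n in F. gval M (p n) = G (p n)"
    using eventually_compose_filterlim[OF MG p(1)] .
  have "((\<lambda>n. 1) \<longlongrightarrow> C) F"
    by (rule Lim_transform_eventually[OF limC]) (use MGp Gpos in eventually_elim, simp)
  then have C1: "C = 1"
    using p(2) by (simp add: tendsto_const_iff)
  have "zs = []"
  proof (cases zs)
    case (Cons z ws)
    obtain C' M' where z: "z = (C', M')" by force
    have C': "C' \<noteq> 0" and M': "growth_monomial M'" using gm[of C' M'] by (simp_all add: ys Cons z)
    have "((\<lambda>x. fval zs x / of_real (gval M' x)) \<longlongrightarrow> C') at_top"
      unfolding Cons z using sorted M' by (intro fval_div_dominant) (auto simp: ys Cons z)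
    from filterlim_compose[OF this p(1)]
    have "((\<lambda>n. fval zs (p n) / of_real (gval M' (p n))) \<longlongrightarrow> C') F" .
    moreover have "\<forall>\<^sub>F n in F. fval zs (p n) / of_real (gval M' (p n)) = 0"
      using eq' MGp by eventually_elim (simp add: ys C1)
    ultimately have "((\<lambda>n. 0) \<longlongrightarrow> C') F"
      by (rule Lim_transform_eventually)
    with C' p(2) show ?thesis by (simp add: tendsto_const_iff)
  qed simp
  with H show ?thesis unfolding ys_def[symmetric] by (auto simp: ys C1)
qed

lemma exp_i_pi_of_nat: "exp (\<i> * of_real (pi * real N)) = (- 1) ^ N"
proof -
  have "exp (\<i> * of_real (pi * real N)) = cis (real N * pi)"
    by (simp add: cis_conv_exp mult.commute)
  also have "\<dots> = cis pi ^ N" unfolding Complex.DeMoivre ..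
  finally show ?thesis by simp
qed

lemma gval_gamma_monomial_of_nat:
  "a > 0 \<Longrightarrow> gval (gamma_monomial a const_1) (real N) = fact N * a ^ N"
  by (simp add: gval_gamma_monomial Gamma_fact add.commute[of _ 1] mult.commute[of "ln a"] exp_of_nat_mult)

lemma mval_even:
  "mval c (real (2 * n)) = fval (map (\<lambda>(A, B, M). (A + B, M)) c) (real (2 * n))"
  unfolding mval_def fval_def exp_i_pi_of_nat by (simp add: o_def case_prod_unfold)

lemma mval_odd:
  "mval c (real (2 * n + 1)) = fval (map (\<lambda>(A, B, M). (A - B, M)) c) (real (2 * n + 1))"
  unfolding mval_def fval_def exp_i_pi_of_nat by (simp add: o_def case_prod_unfold)

text \<open>Along the even and along the odd integers the phase factor is constant, so both \<open>A + B\<close> and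
  \<open>A - B\<close> are determined for every monomial.\<close>

lemma interpolant_fact_power_unique:
  assumes a: "a > 0" and c: "c \<in> mspace"
    and eq: "\<forall>\<^sub>F N in sequentially. mval c (real N) = of_real (fact N * a ^ N)"
  shows "\<exists>H\<in>logexp. c = [(1, 0, gamma_monomial a H)] \<and> (\<forall>\<^sub>F x in at_top. lval H x = 1)"
proof -
  define xs where "xs = map (\<lambda>(A, B, M). (A + B, M)) c"
  define ys where "ys = map (\<lambda>(A, B, M). (A - B, M)) c"
  have gm: "growth_monomial M" "(A, B) \<noteq> (0, 0)" if "(A, B, M) \<in> set c" for A B M
    using c that by (auto simp: mspace_def)
  have sorted: "sorted_wrt (\<lambda>(_, _, M) (_, _, M'). germ_prec (gval M') (gval M)) c"
    using c by (simp add: mspace_def)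
  have even: "filterlim (\<lambda>n. 2 * n) sequentially sequentially"
    and odd: "filterlim (\<lambda>n. 2 * n + 1) sequentially sequentially"
    by (auto intro!: filterlim_subseq simp: strict_mono_def)
  have "\<exists>H\<in>logexp. filter (\<lambda>(C, _). C \<noteq> 0) xs = [(1, gamma_monomial a H)] \<and>
      (\<forall>\<^sub>F x in at_top. lval H x = 1)"
  proof (rule fval_eq_gamma_monomial)
    show "\<forall>(C, M)\<in>set xs. growth_monomial M" using gm by (auto simp: xs_def)
    show "sorted_wrt (\<lambda>(_, M) (_, M'). germ_prec (gval M') (gval M)) xs"
      using sorted by (simp add: xs_def sorted_wrt_map case_prod_unfold)
    show "filterlim (\<lambda>n. real (2 * n)) at_top sequentially"
      by (rule filterlim_compose[OF filterlim_real_sequentially even])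
    show "\<forall>\<^sub>F n in sequentially. fval xs (real (2 * n)) =
        of_real (gval (gamma_monomial a const_1) (real (2 * n)))"
      using eventually_compose_filterlim[OF eq even]
      unfolding gval_gamma_monomial_of_nat[OF a] mval_even xs_def .
  qed simp
  then obtain H where H: "H \<in> logexp" "filter (\<lambda>(C, _). C \<noteq> 0) xs = [(1, gamma_monomial a H)]"
    "\<forall>\<^sub>F x in at_top. lval H x = 1" by auto
  have "\<exists>H\<in>logexp. filter (\<lambda>(C, _). C \<noteq> 0) ys = [(1, gamma_monomial a H)] \<and>
      (\<forall>\<^sub>F x in at_top. lval H x = 1)"
  proof (rule fval_eq_gamma_monomial)
    show "\<forall>(C, M)\<in>set ys. growth_monomial M" using gm by (auto simp: ys_def)
    show "sorted_wrt (\<lambda>(_, M) (_, M'). germ_prec (gval M') (gval M)) ys"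
      using sorted by (simp add: ys_def sorted_wrt_map case_prod_unfold)
    show "filterlim (\<lambda>n. real (2 * n + 1)) at_top sequentially"
      by (rule filterlim_compose[OF filterlim_real_sequentially odd])
    show "\<forall>\<^sub>F n in sequentially. fval ys (real (2 * n + 1)) =
        of_real (gval (gamma_monomial a const_1) (real (2 * n + 1)))"
      using eventually_compose_filterlim[OF eq odd]
      unfolding gval_gamma_monomial_of_nat[OF a] mval_odd ys_def .
  qed simp
  then obtain H' where H': "filter (\<lambda>(C, _). C \<noteq> 0) ys = [(1, gamma_monomial a H')]"
    "\<forall>\<^sub>F x in at_top. lval H' x = 1" by auto
  have G: "\<forall>\<^sub>F x in at_top. gval M x = gval (gamma_monomial a const_1) x" if "(A, B, M) \<in> set c" for A B M
  proof -
    \<comment> \<open>Both vanish only for \<open>A = B = 0\<close>, so every monomial of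
      \<open>c\<close> occurs in \<open>xs\<close> or \<open>ys\<close> after filtering.\<close>
    have "A + B \<noteq> 0 \<or> A - B \<noteq> 0"
      using gm(2)[OF that] by (auto simp: add_eq_0_iff2)
    then have "(A + B, M) \<in> set (filter (\<lambda>(C, _). C \<noteq> 0) xs) \<or>
        (A - B, M) \<in> set (filter (\<lambda>(C, _). C \<noteq> 0) ys)"
      using that by (force simp: xs_def ys_def)
    then have "M = gamma_monomial a H \<or> M = gamma_monomial a H'"
      unfolding H(2) H'(1) by auto
    then obtain K where "M = gamma_monomial a K" "\<forall>\<^sub>F x in at_top. lval K x = 1"
      using H(3) H'(2) by blast
    then show ?thesis
      by (auto simp: gval_gamma_monomial simp del: lval.simps elim!: eventually_mono)
  qed
  obtain p rest where p: "c = p # rest"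
    using H(2) by (cases c) (auto simp: xs_def)
  obtain A B M where ABM: "p = (A, B, M)" by (cases p)
  \<comment> \<open>All monomials of \<open>c\<close> share one germ, so none strictly precedes
    another.\<close>
  have "rest = []"
  proof (cases rest)
    case (Cons q _)
    obtain A' B' M' where q: "q = (A', B', M')" by (cases q)
    have "germ_prec (gval M') (gval M)"
      using sorted by (simp add: p Cons q ABM)
    moreover have "\<forall>\<^sub>F x in at_top. gval M' x / gval M x = 1"
    proof -
      have in_c: "(A, B, M) \<in> set c" "(A', B', M') \<in> set c" by (simp_all add: p Cons q ABM)
      from G[OF in_c(1)] G[OF in_c(2)] eventually_gval_pos[OF gm(1)[OF in_c(1)]]
      show ?thesis by eventually_elim simp
    qed
    ultimately have "((\<lambda>x::real. 1::real) \<longlongrightarrow> 0) at_top"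
      unfolding germ_prec_def by (rule Lim_transform_eventually)
    then show ?thesis by (simp add: tendsto_const_iff)
  qed simp
  then have c1: "c = [(A, B, M)]" by (simp add: p ABM)
  have AB: "A + B = 1" "A - B = 1" and "M = gamma_monomial a H"
    using H(2) H'(1) by (auto simp: xs_def ys_def c1 split: if_splits)
  have "2 * A = (A + B) + (A - B)" by simp
  then have "A = 1" unfolding AB by simp
  with AB(1) have "A = 1 \<and> B = 0" by simp
  with H c1 \<open>M = gamma_monomial a H\<close> show ?thesis by auto
qed


section \<open>Fourier inversion\<close>

lemma integral_std_normal_iexp:
  "(LINT v|lborel. iexp (t * v) * of_real (std_normal_density v)) = of_real (exp (- t\<^sup>2 / 2))"
proof -
  have "char std_normal_distribution t = (LINT v|lborel. std_normal_density v *\<^sub>R iexp (t * v))"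
    unfolding char_def by (subst integral_density) (auto simp: normal_density_nonneg)
  then show ?thesis
    by (simp add: char_std_normal_distribution scaleR_conv_of_real mult.commute)
qed

lemma integrable_std_normal_density: "integrable lborel std_normal_density"
  using integrable_std_normal_moment[of 0] by simp

lemma integral_std_normal_density: "(LINT v|lborel. std_normal_density v) = 1"
  using integral_std_normal_moment_even[of 0] by simp

lemma integral_scaled_normal_iexp:
  assumes "\<delta> > 0"
  shows "(LINT t|lborel. iexp (t * w) * of_real (std_normal_density (\<delta> * t))) =
    of_real (sqrt (2 * pi) / \<delta> * std_normal_density (w / \<delta>))"
proof -
  have "(LINT t|lborel. iexp (t * w) * of_real (std_normal_density (\<delta> * t))) =
      \<bar>1 / \<delta>\<bar> *\<^sub>R (LINT v|lborel. iexp ((0 + 1 / \<delta> * v) * w) * of_real (std_normal_density (\<delta> * (0 + 1 / \<delta> * v))))"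
    using assms by (intro lborel_integral_real_affine) simp
  also have "\<dots> = (1 / \<delta>) *\<^sub>R (LINT v|lborel. iexp ((w / \<delta>) * v) * of_real (std_normal_density v))"
    using assms by (simp add: mult_ac)
  also have "\<dots> = (1 / \<delta>) *\<^sub>R of_real (exp (- (w / \<delta>)\<^sup>2 / 2))"
    by (subst integral_std_normal_iexp) simp
  also have "\<dots> = of_real (sqrt (2 * pi) / \<delta> * std_normal_density (w / \<delta>))"
    by (simp add: std_normal_density_def scaleR_conv_of_real)
  finally show ?thesis .
qed

text \<open>The Gaussian cutoff makes the double integral absolutely convergent. After Fubini the
  inner integral is a Gaussian of width \<open>\<delta>\<close> centred at \<open>y\<close>.\<close>

lemma fourier_inversion_gaussian:
  fixes f :: "real \<Rightarrow> complex"
  assumes f: "integrable lborel f" and \<delta>: "\<delta> > 0"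
  shows "(LINT t|lborel. (LINT u|lborel. f u * iexp (t * u)) * iexp (- (t * y)) * of_real (std_normal_density (\<delta> * t))) =
    of_real (sqrt (2 * pi)) * (LINT v|lborel. f (y + \<delta> * v) * of_real (std_normal_density v))"
proof -
  define K where "K t u = f u * iexp (t * (u - y)) * of_real (std_normal_density (\<delta> * t))" for t u
  have [measurable]: "f \<in> borel_measurable borel" using f by simp
  have meas: "case_prod K \<in> borel_measurable (lborel \<Otimes>\<^sub>M lborel)"
    unfolding K_def by measurable
  have intd: "integrable lborel (\<lambda>t. std_normal_density (\<delta> * t))"
    using lborel_integrable_real_affine[OF integrable_std_normal_density, of \<delta> 0] \<delta> by simp
  have normK: "norm (K t u) = norm (f u) * std_normal_density (\<delta> * t)" for t u
    by (simp add: K_def norm_mult)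
  have int: "integrable (lborel \<Otimes>\<^sub>M lborel) (case_prod K)"
  proof (rule lborel_pair.Fubini_integrable[OF meas])
    show "integrable lborel (\<lambda>t. LINT u|lborel. norm (case (t, u) of (t, u) \<Rightarrow> K t u))"
      using intd by (simp add: normK)
    show "AE t in lborel. integrable lborel (\<lambda>u. case (t, u) of (t, u) \<Rightarrow> K t u)"
    proof (intro AE_I2)
      fix t
      show "integrable lborel (\<lambda>u. case (t, u) of (t, u) \<Rightarrow> K t u)"
        by (rule Bochner_Integration.integrable_bound[of lborel "\<lambda>u. norm (f u) * std_normal_density (\<delta> * t)"])
          (use f in \<open>auto simp: K_def norm_mult\<close>)
    qed
  qed
  have "(LINT t|lborel. (LINT u|lborel. f u * iexp (t * u)) * iexp (- (t * y)) * of_real (std_normal_density (\<delta> * t))) =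
      (LINT t|lborel. LINT u|lborel. K t u)"
  proof (rule Bochner_Integration.integral_cong[OF refl])
    fix t
    have "(LINT u|lborel. K t u) = (LINT u|lborel. f u * iexp (t * u) * (iexp (- (t * y)) * of_real (std_normal_density (\<delta> * t))))"
      by (rule Bochner_Integration.integral_cong[OF refl])
        (simp add: K_def algebra_simps exp_diff exp_minus divide_inverse)
    then show "(LINT u|lborel. f u * iexp (t * u)) * iexp (- (t * y)) * of_real (std_normal_density (\<delta> * t)) =
        (LINT u|lborel. K t u)"
      by (simp only: mult.assoc[symmetric] integral_mult_left_zero)
  qed
  also have "\<dots> = (LINT u|lborel. LINT t|lborel. K t u)"
    by (rule lborel_pair.Fubini_integral[OF int, symmetric])
  also have "\<dots> = (LINT u|lborel. f u * of_real (sqrt (2 * pi) / \<delta> * std_normal_density ((u - y) / \<delta>)))"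
    unfolding K_def mult.assoc by (simp add: integral_scaled_normal_iexp[OF \<delta>] del: of_real_mult)
  also have "\<dots> = \<bar>\<delta>\<bar> *\<^sub>R (LINT v|lborel. f (y + \<delta> * v) *
      of_real (sqrt (2 * pi) / \<delta> * std_normal_density ((y + \<delta> * v - y) / \<delta>)))"
    using \<delta> by (intro lborel_integral_real_affine) simp
  also have "\<dots> = \<delta> *\<^sub>R (LINT v|lborel. of_real (sqrt (2 * pi) / \<delta>) *
      (f (y + \<delta> * v) * of_real (std_normal_density v)))"
    using \<delta> by (simp add: mult_ac)
  also have "\<dots> = of_real (sqrt (2 * pi)) * (LINT v|lborel. f (y + \<delta> * v) * of_real (std_normal_density v))"
    using \<delta> by (simp add: scaleR_conv_of_real)
  finally show ?thesis .
qed

text \<open>The cutoff is removed by dominated convergence on both sides, with majorants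
  \<open>norm (Ft t)\<close> and \<open>B * std_normal_density v\<close>; continuity gives the limit
  \<open>f y\<close>.\<close>

lemma fourier_inversion:
  fixes f :: "real \<Rightarrow> complex"
  assumes f: "integrable lborel f" "continuous_on UNIV f" "\<And>x. norm (f x) \<le> B"
    and F: "integrable lborel (\<lambda>t. LINT u|lborel. f u * iexp (t * u))"
  shows "(LINT t|lborel. (LINT u|lborel. f u * iexp (t * u)) * iexp (- (t * y))) = of_real (2 * pi) * f y"
proof -
  define Ft where "Ft t = (LINT u|lborel. f u * iexp (t * u))" for t
  have [measurable]: "f \<in> borel_measurable borel" "Ft \<in> borel_measurable borel"
    using f(1) F by (simp_all add: Ft_def[abs_def])
  have \<delta>: "(\<lambda>n. 1 / real (Suc n)) \<longlonglongrightarrow> 0"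
    using LIMSEQ_inverse_real_of_nat by (simp add: inverse_eq_divide)
  have "(\<lambda>n. LINT t|lborel. Ft t * iexp (- (t * y)) * of_real (std_normal_density (1 / real (Suc n) * t)))
      \<longlonglongrightarrow> (LINT t|lborel. Ft t * iexp (- (t * y)) * of_real (std_normal_density 0))"
  proof (rule integral_dominated_convergence[where w = "\<lambda>t. norm (Ft t)"])
    show "integrable lborel (\<lambda>t. norm (Ft t))" using F by (simp add: Ft_def)
    show "AE t in lborel. (\<lambda>n. Ft t * iexp (- (t * y)) * of_real (std_normal_density (1 / real (Suc n) * t)))
        \<longlonglongrightarrow> Ft t * iexp (- (t * y)) * of_real (std_normal_density 0)"
    proof (intro AE_I2 tendsto_intros)
      fix t
      have "isCont std_normal_density 0"
        unfolding std_normal_density_def by (intro continuous_intros) auto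
      then show "(\<lambda>n. std_normal_density (1 / real (Suc n) * t)) \<longlonglongrightarrow> std_normal_density 0"
        using tendsto_mult_left_zero[OF \<delta>, of t] isCont_tendsto_compose by blast
    qed
    show "AE t in lborel. norm (Ft t * iexp (- (t * y)) * of_real (std_normal_density (1 / real (Suc n) * t))) \<le> norm (Ft t)" for n
    proof (intro AE_I2)
      fix t
      have "std_normal_density x \<le> 1" for x
      proof -
        have "1 \<le> sqrt (2 * pi)" using pi_gt3 by (simp add: real_le_rsqrt)
        then have "1 / sqrt (2 * pi) * exp (- x\<^sup>2 / 2) \<le> 1 * 1"
          by (intro mult_mono) auto
        then show ?thesis by (simp add: std_normal_density_def)
      qed
      then show "norm (Ft t * iexp (- (t * y)) * of_real (std_normal_density (1 / real (Suc n) * t))) \<le> norm (Ft t)"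
        by (simp add: norm_mult mult_left_le)
    qed
  qed measurable
  then have "(\<lambda>n. of_real (sqrt (2 * pi)) * (LINT v|lborel. f (y + 1 / real (Suc n) * v) * of_real (std_normal_density v)))
      \<longlonglongrightarrow> (LINT t|lborel. Ft t * iexp (- (t * y)) * of_real (std_normal_density 0))"
  proof (rule Lim_transform_eventually, intro always_eventually allI)
    show "(LINT t|lborel. Ft t * iexp (- (t * y)) * of_real (std_normal_density (1 / real (Suc n) * t))) =
     of_real (sqrt (2 * pi)) * (LINT v|lborel. f (y + 1 / real (Suc n) * v) * of_real (std_normal_density v))" for n
      unfolding Ft_def by (rule fourier_inversion_gaussian[OF f(1)]) simp
  qed
  moreover have "(\<lambda>n. of_real (sqrt (2 * pi)) * (LINT v|lborel. f (y + 1 / real (Suc n) * v) * of_real (std_normal_density v)))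
      \<longlonglongrightarrow> of_real (sqrt (2 * pi)) * (LINT v|lborel. f y * of_real (std_normal_density v))"
  proof (intro tendsto_mult tendsto_const integral_dominated_convergence[where w = "\<lambda>v. B * std_normal_density v"])
    show "integrable lborel (\<lambda>v. B * std_normal_density v)"
      using integrable_std_normal_density by simp
    show "AE v in lborel. (\<lambda>n. f (y + 1 / real (Suc n) * v) * of_real (std_normal_density v))
        \<longlonglongrightarrow> f y * of_real (std_normal_density v)"
    proof (intro AE_I2 tendsto_intros)
      fix v
      have "isCont f y" using f(2) by (simp add: continuous_on_eq_continuous_at)
      moreover have "(\<lambda>n. y + 1 / real (Suc n) * v) \<longlonglongrightarrow> y + 0 * v"
        by (intro tendsto_intros \<delta>)
      ultimately show "(\<lambda>n. f (y + 1 / real (Suc n) * v)) \<longlonglongrightarrow> f y"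
        using isCont_tendsto_compose[of y f] by simp
    qed
    show "AE v in lborel. norm (f (y + 1 / real (Suc n) * v) * of_real (std_normal_density v)) \<le> B * std_normal_density v" for n
      using f(3) by (intro AE_I2) (auto simp: norm_mult normal_density_nonneg intro!: mult_right_mono)
  qed measurable
  ultimately have "(LINT t|lborel. Ft t * iexp (- (t * y)) * of_real (std_normal_density 0)) =
      of_real (sqrt (2 * pi)) * (LINT v|lborel. f y * of_real (std_normal_density v))"
    by (rule LIMSEQ_unique)
  also have "(LINT v|lborel. f y * of_real (std_normal_density v)) = f y"
    using integral_std_normal_density by (simp add: integral_complex_of_real)
  \<comment> \<open>\<open>std_normal_density 0\<close> is \<open>1 / sqrt (2 * pi)\<close>, which
    accounts for the second square root.\<close>
  finally have "(LINT t|lborel. Ft t * iexp (- (t * y))) * of_real (1 / sqrt (2 * pi)) = of_real (sqrt (2 * pi)) * f y"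
    by (simp add: std_normal_density_def)
  then have "(LINT t|lborel. Ft t * iexp (- (t * y))) = of_real (sqrt (2 * pi)) * of_real (sqrt (2 * pi)) * f y"
    by (simp add: field_simps)
  also have "of_real (sqrt (2 * pi)) * of_real (sqrt (2 * pi)) = complex_of_real (2 * pi)"
    unfolding of_real_mult[symmetric] by simp
  finally show ?thesis unfolding Ft_def .
qed


section \<open>The Bromwich transform of a gamma monomial\<close>

lemma has_bochner_integral_lborel_if_absolutely_integrable:
  fixes f :: "real \<Rightarrow> complex"
  assumes "f absolutely_integrable_on UNIV" "f \<in> borel_measurable borel"
  shows "has_bochner_integral lborel f (integral UNIV f)"
proof -
  \<comment> \<open>Absolute integrability refers to the completed measure; for Borel functions the
    integrals agree.\<close>
  have "integrable lebesgue f"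
    using assms(1) by (simp add: set_integrable_def)
  then have int: "integrable lborel f"
    using assms(2) by (simp add: integrable_completion)
  have "(LINT x|lborel. f x) = (LINT x|lebesgue. f x)"
    using assms(2) by (simp add: integral_completion)
  also have "\<dots> = integral UNIV f"
    using set_lebesgue_integral_eq_integral(2)[OF assms(1)] by (simp add: set_lebesgue_integral_def)
  finally show ?thesis
    using int by (simp add: has_bochner_integral_iff)
qed

text \<open>Euler's integral after \<open>t = exp u\<close>, whose Jacobian raises the exponent from
  \<open>s - 1\<close> to \<open>s\<close>. On a line of constant real part this is a Fourier
  transform.\<close>

lemma Gamma_fourier_integral:
  assumes "Re s > 0"
  shows "has_bochner_integral lborel (\<lambda>u. exp (s * of_real u) * of_real (exp (- exp u))) (Gamma s)"
proof -
  define f where "f t = complex_of_real t powr (s - 1) / of_real (exp t)" for t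
  have eq: "\<bar>exp u\<bar> *\<^sub>R f (exp u) = exp (s * of_real u) * of_real (exp (- exp u))" for u :: real
    by (simp add: f_def powr_def scaleR_conv_of_real exp_of_real[symmetric] exp_minus divide_inverse
        algebra_simps exp_diff exp_minus del: exp_of_real)
  have "(\<lambda>u. \<bar>exp u\<bar> *\<^sub>R f (exp u)) absolutely_integrable_on UNIV \<and>
      integral UNIV (\<lambda>u. \<bar>exp u\<bar> *\<^sub>R f (exp u)) = Gamma s \<longleftrightarrow>
      f absolutely_integrable_on (exp ` UNIV) \<and> integral (exp ` UNIV) f = Gamma s"
    by (intro has_absolute_integral_change_of_variables_real)
      (auto intro!: derivative_eq_intros inj_onI)
  moreover have "range exp = {0::real<..}"
    using exp_ln by (auto intro: range_eqI[of _ _ "ln _"] simp: image_iff) (metis exp_ln)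
  moreover have "f absolutely_integrable_on {0<..}" "integral {0<..} f = Gamma s"
    using absolutely_integrable_Gamma_integral'[OF assms] Gamma_integral_complex'[OF assms]
    by (auto simp: f_def[abs_def] integral_unique)
  ultimately show ?thesis
    using has_bochner_integral_lborel_if_absolutely_integrable[of "\<lambda>u. exp (s * of_real u) * of_real (exp (- exp u))"]
    unfolding eq by auto
qed

lemma norm_Gamma_le:
  assumes "Re s > 0"
  shows "norm (Gamma s) \<le> Gamma (Re s)"
proof -
  note G = Gamma_fourier_integral[OF assms]
  have "Re (of_real (Re s)) > 0" using assms by simp
  note GR = Gamma_fourier_integral[OF this]
  have "norm (Gamma s) = norm (LINT u|lborel. exp (s * of_real u) * of_real (exp (- exp u)))"
    using G by (simp add: has_bochner_integral_integral_eq)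
  also have "\<dots> \<le> (LINT u|lborel. norm (exp (s * of_real u) * complex_of_real (exp (- exp u))))"
    by (rule integral_norm_bound)
  finally have le: "norm (Gamma s) \<le> (LINT u|lborel. norm (exp (s * of_real u) * complex_of_real (exp (- exp u))))" .
  have "of_real (LINT u|lborel. norm (exp (s * of_real u) * complex_of_real (exp (- exp u)))) =
      (LINT u|lborel. complex_of_real (norm (exp (s * of_real u) * complex_of_real (exp (- exp u)))))"
    by (rule integral_complex_of_real[symmetric])
  also have "\<dots> = (LINT u|lborel. exp (of_real (Re s) * of_real u) * of_real (exp (- exp u)))"
    by (rule Bochner_Integration.integral_cong[OF refl]) (simp add: norm_mult flip: exp_of_real)
  also have "\<dots> = of_real (Gamma (Re s))"
    using GR by (simp add: has_bochner_integral_integral_eq Gamma_complex_of_real)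
  finally show ?thesis using le by (simp only: of_real_eq_iff)
qed

lemma integrable_lborel_inverse_1_plus_square: "integrable lborel (\<lambda>t::real. inverse (1 + t\<^sup>2))"
  using integrable_inverse_1_plus_square by (simp add: set_integrable_def)

text \<open>Two steps of the functional equation give quadratic decay on vertical lines.\<close>

lemma integrable_Gamma_vertical:
  assumes "c \<ge> 1"
  shows "integrable lborel (\<lambda>t. Gamma (Complex c t))"
proof -
  have cont: "continuous_on UNIV (\<lambda>t. Gamma (Complex c t))"
  proof (rule continuous_on_compose2[of "{z. Re z > 0}" Gamma])
    show "continuous_on {z::complex. Re z > 0} Gamma"
      by (rule continuous_on_Gamma) (auto elim!: nonpos_Ints_cases)
    show "continuous_on UNIV (Complex c)"
      unfolding Complex_eq by (intro continuous_intros)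
  qed (use assms in auto)
  have bound: "norm (Gamma (Complex c t)) \<le> Gamma (c + 2) * inverse (1 + t\<^sup>2)" for t
  proof -
    define s where "s = Complex c t"
    have s: "s \<notin> \<int>\<^sub>\<le>\<^sub>0" "s + 1 \<notin> \<int>\<^sub>\<le>\<^sub>0"
      using assms by (auto simp: s_def complex_eq_iff elim!: nonpos_Ints_cases)
    have "Gamma (s + 1 + 1) = (s + 1) * (s * Gamma s)"
      by (simp only: Gamma_plus1[OF s(2)] Gamma_plus1[OF s(1)])
    then have "norm (Gamma (s + 2)) = norm (s + 1) * norm s * norm (Gamma s)"
      by (simp add: norm_mult add.assoc)
    moreover have "1 + t\<^sup>2 \<le> norm (s + 1) * norm s"
    proof -
      have "1 + t\<^sup>2 \<le> c\<^sup>2 + t\<^sup>2" using assms by (simp add: one_le_power)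
      also have "\<dots> = norm s * norm s"
        by (simp add: s_def cmod_power2[symmetric] power2_eq_square[symmetric] cmod_def)
      also have "\<dots> \<le> norm (s + 1) * norm s"
        using assms by (intro mult_right_mono) (auto simp: s_def cmod_def intro!: power_mono)
      finally show ?thesis .
    qed
    ultimately have "(1 + t\<^sup>2) * norm (Gamma s) \<le> norm (Gamma (s + 2))"
      by (metis mult_right_mono norm_ge_zero)
    also have "\<dots> \<le> Gamma (Re (s + 2))"
      using assms by (intro norm_Gamma_le) (simp add: s_def)
    finally have "(1 + t\<^sup>2) * norm (Gamma s) \<le> Gamma (c + 2)"
      by (simp add: s_def)
    moreover have "1 + t\<^sup>2 > 0" by (simp add: add_pos_nonneg)
    ultimately show ?thesis
      by (simp add: s_def field_simps)
  qed
  show ?thesis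
  proof (rule Bochner_Integration.integrable_bound)
    show "integrable lborel (\<lambda>t. Gamma (c + 2) * inverse (1 + t\<^sup>2))"
      using integrable_lborel_inverse_1_plus_square by simp
    show "(\<lambda>t. Gamma (Complex c t)) \<in> borel_measurable lborel"
      using borel_measurable_continuous_onI[OF cont] by simp
    show "AE t in lborel. norm (Gamma (Complex c t)) \<le> norm (Gamma (c + 2) * inverse (1 + t\<^sup>2))"
      using bound by (intro AE_I2) (smt (verit) real_norm_def)
  qed
qed

text \<open>The bound is the value at the maximum \<open>w = ln c\<close>.\<close>

lemma exp_linear_minus_exp_le:
  fixes c w :: real
  assumes "c > 0"
  shows "c * w - exp w \<le> c * ln c - c"
proof -
  have "1 + (w - ln c) \<le> exp (w - ln c)" by (rule exp_ge_add_one_self)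
  also have "\<dots> = exp w / c" using assms by (simp add: exp_diff)
  finally show ?thesis using assms by (simp add: field_simps)
qed

text \<open>Mellin inversion: \<open>Gamma (Complex c t)\<close> is the Fourier transform of
  \<open>exp (c * w - exp w)\<close>, which is continuous, bounded and integrable, and the transform
  is integrable by its quadratic decay.\<close>

lemma Gamma_inverse_fourier:
  assumes c: "c \<ge> 1"
  shows "(LINT t|lborel. Gamma (Complex c t) * iexp (- (t * y))) =
    of_real (2 * pi * (exp (c * y) * exp (- exp y)))"
proof -
  define f where "f w = exp (of_real c * of_real w) * complex_of_real (exp (- exp w))" for w :: real
  have F: "(LINT u|lborel. f u * iexp (t * u)) = Gamma (Complex c t)" for t
  proof -
    have "f u * iexp (t * u) = exp (Complex c t * of_real u) * of_real (exp (- exp u))" for u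
    proof -
      have "Complex c t * of_real u = of_real c * of_real u + \<i> * of_real (t * u)"
        by (simp add: Complex_eq algebra_simps)
      then show ?thesis by (simp only: f_def exp_add mult_ac)
    qed
    then show ?thesis
      using Gamma_fourier_integral[of "Complex c t"] c by (simp add: has_bochner_integral_integral_eq)
  qed
  have "(LINT t|lborel. (LINT u|lborel. f u * iexp (t * u)) * iexp (- (t * y))) = of_real (2 * pi) * f y"
  proof (rule fourier_inversion)
    show "integrable lborel f"
      using Gamma_fourier_integral[of "of_real c"] c unfolding f_def[abs_def] by (simp add: has_bochner_integral_iff)
    show "continuous_on UNIV f"
      unfolding f_def by (intro continuous_intros)
    show "norm (f w) \<le> exp (c * ln c - c)" for w
    proof -
      have "norm (f w) = exp (c * w - exp w)"
        by (simp add: f_def norm_mult exp_diff exp_minus divide_inverse norm_inverse)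
      then show ?thesis using exp_linear_minus_exp_le[of c w] c by simp
    qed
    show "integrable lborel (\<lambda>t. LINT u|lborel. f u * iexp (t * u))"
      unfolding F by (rule integrable_Gamma_vertical[OF c])
  qed
  then show ?thesis
    unfolding F by (simp add: f_def flip: exp_of_real)
qed

section \<open>The transform kernel\<close>

definition gamma_kernel :: "real \<Rightarrow> real \<Rightarrow> real" where
  "gamma_kernel a u = exp (u - ln a) * exp (- exp (u - ln a))"

text \<open>Euler's integral at \<open>N + 1\<close>, as the kernel itself contributes one
  exponential factor; the shift of the variable by \<open>ln a\<close> produces
  \<open>a ^ N\<close>.\<close>

lemma gamma_kernel_moment:
  assumes "a > 0"
  shows "has_bochner_integral lborel (\<lambda>u. gamma_kernel a u * exp (real N * u)) (fact N * a ^ N)"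
proof -
  define f where "f w = a ^ N * (exp (real (Suc N) * w) * exp (- exp w))" for w :: real
  have "has_bochner_integral lborel (\<lambda>u. complex_of_real (exp (real (Suc N) * u) * exp (- exp u))) (of_real (fact N))"
    using Gamma_fourier_integral[of "of_nat (Suc N)"] Gamma_fact[of N, where ?'a = complex]
    by (simp add: exp_of_real[symmetric] del: exp_of_real)
  from has_bochner_integral_Re[OF this]
  have "has_bochner_integral lborel f (a ^ N * fact N)"
    unfolding f_def[abs_def] by (intro has_bochner_integral_mult_right) simp
  then have "has_bochner_integral lborel (\<lambda>u. f (- ln a + 1 * u)) ((a ^ N * fact N) /\<^sub>R \<bar>1\<bar>)"
    using lborel_has_bochner_integral_real_affine_iff[of 1 f "a ^ N * fact N" "- ln a"] by simp
  moreover have "f (- ln a + 1 * u) = gamma_kernel a u * exp (real N * u)" for u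
  proof -
    have "a ^ N = exp (real N * ln a)" using assms by (simp add: exp_of_nat_mult)
    then have "f (- ln a + 1 * u) = exp (real N * ln a + real (Suc N) * (u - ln a)) * exp (- exp (u - ln a))"
      by (simp add: f_def exp_add)
    also have "real N * ln a + real (Suc N) * (u - ln a) = (u - ln a) + real N * u"
      by (simp add: algebra_simps)
    finally show ?thesis by (simp add: gamma_kernel_def exp_add)
  qed
  ultimately show ?thesis by (simp add: mult.commute)
qed

text \<open>On the line the factors \<open>a^z\<close> and \<open>exp (- u * z)\<close> merge into
  \<open>exp (- (u - ln a) * z)\<close>, so \<open>a\<close> only translates \<open>u\<close>. The
  argument \<open>z + 1\<close> of Gamma moves the abscissa to \<open>\<sigma> + 1\<close>.\<close>

lemma bromwich_integrand_gamma_monomial: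
  assumes "\<forall>z. Re z \<ge> x0 \<longrightarrow> lcont H z = 1" "\<sigma> \<ge> x0"
  shows "bromwich_integrand [(1, gamma_monomial a H)] \<sigma> u t =
    \<i> * of_real (exp (- (u - ln a) * \<sigma>)) * (Gamma (Complex (\<sigma> + 1) t) * iexp (- (t * (u - ln a))))"
proof -
  define y where "y = u - ln a"
  have "exp (of_real (ln a) * Complex \<sigma> t) * exp (- (of_real u * Complex \<sigma> t)) = exp (- of_real y * Complex \<sigma> t)"
    by (simp add: y_def algebra_simps flip: exp_add)
  also have "- of_real y * Complex \<sigma> t = of_real (- y * \<sigma>) + \<i> * of_real (- (t * y))"
    by (simp add: Complex_eq algebra_simps)
  also have "exp \<dots> = of_real (exp (- y * \<sigma>)) * iexp (- (t * y))"
    by (simp only: exp_add exp_of_real)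
  finally have e: "exp (of_real (ln a) * Complex \<sigma> t) * exp (- (of_real u * Complex \<sigma> t)) =
      of_real (exp (- y * \<sigma>)) * iexp (- (t * y))" .
  have "lcont H (Complex \<sigma> t) = 1" using assms by simp
  moreover have "Complex \<sigma> t + 1 = Complex (\<sigma> + 1) t" by (simp add: complex_eq_iff)
  ultimately have "bromwich_integrand [(1, gamma_monomial a H)] \<sigma> u t =
      \<i> * (exp (of_real (ln a) * Complex \<sigma> t) * exp (- (of_real u * Complex \<sigma> t))) * Gamma (Complex (\<sigma> + 1) t)"
    by (simp add: bromwich_integrand_def fcont_def gamma_monomial_def del: lcont.simps)
  also have "\<dots> = \<i> * of_real (exp (- y * \<sigma>)) * (Gamma (Complex (\<sigma> + 1) t) * iexp (- (t * y)))"
    unfolding e by (simp only: mult_ac)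
  finally show ?thesis unfolding y_def .
qed

lemma bromwich_integrand_gamma_monomial_ext:
  assumes "\<forall>z. Re z \<ge> x0 \<longrightarrow> lcont H z = 1" "\<sigma> \<ge> x0"
  shows "bromwich_integrand [(1, gamma_monomial a H)] \<sigma> u =
    (\<lambda>t. \<i> * of_real (exp (- (u - ln a) * \<sigma>)) * (Gamma (Complex (\<sigma> + 1) t) * iexp (- (t * (u - ln a)))))"
  by (rule ext) (rule bromwich_integrand_gamma_monomial[OF assms])

lemma bromwich_line_gamma_monomial:
  assumes "\<forall>z. Re z \<ge> x0 \<longrightarrow> lcont H z = 1" "\<sigma> \<ge> x0" "\<sigma> \<ge> 0"
  shows "bromwich_line [(1, gamma_monomial a H)] \<sigma> u = of_real (gamma_kernel a u)"
proof -
  define y where "y = u - ln a"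
  have "bromwich_line [(1, gamma_monomial a H)] \<sigma> u = 1 / (2 * of_real pi * \<i>) * (\<i> * of_real (exp (- y * \<sigma>)) *
      of_real (2 * pi * (exp ((\<sigma> + 1) * y) * exp (- exp y))))"
    unfolding bromwich_line_def bromwich_integrand_gamma_monomial_ext[OF assms(1,2)] y_def[symmetric]
    by (subst integral_mult_right_zero, subst Gamma_inverse_fourier) (use assms(3) in auto)
  also have "\<dots> = of_real (exp (- y * \<sigma>) * exp ((\<sigma> + 1) * y) * exp (- exp y))"
    by (simp add: field_simps)
  \<comment> \<open>The dependence on the abscissa cancels, which is the required independence of
    \<open>\<sigma>\<close>.\<close>
  also have "exp (- y * \<sigma>) * exp ((\<sigma> + 1) * y) = exp y"
    by (simp add: algebra_simps flip: exp_add)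
  finally show ?thesis by (simp add: gamma_kernel_def y_def)
qed

text \<open>The abscissa \<open>x0\<close> may be arbitrarily large, since \<open>bromwich\<close>
  asks only for all large \<open>\<sigma>\<close>.\<close>

lemma bromwich_gamma_monomial:
  assumes "\<forall>z. Re z \<ge> x0 \<longrightarrow> lcont H z = 1"
  shows "bromwich [(1, gamma_monomial a H)] u = of_real (gamma_kernel a u)"
  unfolding bromwich_def
proof (rule the_equality)
  have ev: "\<forall>\<^sub>F \<sigma> in at_top. bromwich_line [(1, gamma_monomial a H)] \<sigma> u = of_real (gamma_kernel a u)"
    using eventually_ge_at_top[of x0] eventually_ge_at_top[of 0]
    by eventually_elim (rule bromwich_line_gamma_monomial[OF assms])
  then show "\<forall>\<^sub>F \<sigma> in at_top. bromwich_line [(1, gamma_monomial a H)] \<sigma> u = of_real (gamma_kernel a u)" .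
  fix v assume "\<forall>\<^sub>F \<sigma> in at_top. bromwich_line [(1, gamma_monomial a H)] \<sigma> u = v"
  with ev have "\<forall>\<^sub>F \<sigma>::real in at_top. v = of_real (gamma_kernel a u)"
    by eventually_elim simp
  then show "v = of_real (gamma_kernel a u)" by simp
qed

lemma bromwich_admissible_gamma_monomial:
  assumes a: "a > 0"
  shows "bromwich_admissible [(1, gamma_monomial a const_1)]"
  unfolding bromwich_admissible_def
proof (intro conjI exI[of _ 0] allI impI)
  have const: "\<forall>z. Re z \<ge> 0 \<longrightarrow> lcont const_1 z = 1" by simp
  show "[(1, gamma_monomial a const_1)] \<in> mflat"
    by (simp add: mflat_def)
  fix \<sigma> :: real assume \<sigma>: "\<sigma> > 0"
  show "AE u in lborel. integrable lborel (bromwich_integrand [(1, gamma_monomial a const_1)] \<sigma> u)"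
  proof (intro AE_I2)
    fix u
    have G: "integrable lborel (\<lambda>t. Gamma (Complex (\<sigma> + 1) t))"
      using \<sigma> by (intro integrable_Gamma_vertical) simp
    have "integrable lborel (\<lambda>t. Gamma (Complex (\<sigma> + 1) t) * iexp (- (t * (u - ln a))))"
      by (rule Bochner_Integration.integrable_bound[OF G])
        (use borel_measurable_integrable[OF G] in \<open>auto simp: norm_mult\<close>)
    then show "integrable lborel (bromwich_integrand [(1, gamma_monomial a const_1)] \<sigma> u)"
      unfolding bromwich_integrand_gamma_monomial_ext[OF const less_imp_le[OF \<sigma>]]
      by (rule integrable_mult_right)
  qed
  show "bromwich_line [(1, gamma_monomial a const_1)] \<sigma> u = bromwich_line [(1, gamma_monomial a const_1)] \<tau> u"
    if "\<tau> > 0" for \<tau> u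
    using \<sigma> that bromwich_line_gamma_monomial[OF const] by simp
  show "\<forall>\<^sub>F N in sequentially.
       integrable lborel (\<lambda>u. bromwich [(1, gamma_monomial a const_1)] u * of_real (exp (real N * u))) \<and>
       (LINT u|lborel. bromwich [(1, gamma_monomial a const_1)] u * of_real (exp (real N * u))) =
       fval [(1, gamma_monomial a const_1)] (real N)"
  proof (intro always_eventually allI)
    fix N
    have "has_bochner_integral lborel (\<lambda>u. complex_of_real (gamma_kernel a u * exp (real N * u)))
        (of_real (fact N * a ^ N))"
      by (rule has_bochner_integral_of_real[OF gamma_kernel_moment[OF a]])
    then show "integrable lborel (\<lambda>u. bromwich [(1, gamma_monomial a const_1)] u * of_real (exp (real N * u))) \<and>
       (LINT u|lborel. bromwich [(1, gamma_monomial a const_1)] u * of_real (exp (real N * u))) =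
       fval [(1, gamma_monomial a const_1)] (real N)"
      by (simp add: bromwich_gamma_monomial[OF const] gval_gamma_monomial_of_nat[OF a] has_bochner_integral_iff)
  qed
qed


section \<open>Principal values and the exponential integral\<close>

abbreviation excision :: "real \<Rightarrow> real \<Rightarrow> real set" where
  "excision \<alpha> \<beta> \<equiv> {t. t < - \<alpha> \<or> t > \<beta>}"

lemma abs_greater_eq_excision: "{u. \<bar>u\<bar> > \<epsilon>} = excision \<epsilon> (\<epsilon>::real)"
  by auto

lemma excision_sets [measurable]: "excision \<alpha> \<beta> \<in> sets borel"
  by measurable

text \<open>Dominated convergence. The two radii are separate functions because the substitution in
  the selector does not preserve symmetric excisions.\<close>

lemma tendsto_integral_excision:
  fixes g :: "real \<Rightarrow> 'a :: {banach, second_countable_topology}" and \<alpha> \<beta> :: "real \<Rightarrow> real"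
  assumes g: "set_integrable lborel S g" and S [measurable]: "S \<in> sets borel"
    and "(\<alpha> \<longlongrightarrow> 0) (at_right 0)" "(\<beta> \<longlongrightarrow> 0) (at_right 0)"
  shows "((\<lambda>\<epsilon>. LINT t:S \<inter> excision (\<alpha> \<epsilon>) (\<beta> \<epsilon>)|lborel. g t) \<longlongrightarrow> (LINT t:S|lborel. g t)) (at_right 0)"
proof (rule tendsto_at_right_sequentially[OF zero_less_one])
  fix e :: "nat \<Rightarrow> real"
  assume e: "\<And>n. 0 < e n" "e \<longlonglongrightarrow> 0"
  then have "filterlim e (at_right 0) sequentially"
    by (auto intro!: tendsto_imp_filterlim_at_right)
  note \<alpha> = filterlim_compose[OF assms(3) this] and \<beta> = filterlim_compose[OF assms(4) this]
  have meas: "(\<lambda>t. indicator S t *\<^sub>R g t) \<in> borel_measurable lborel"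
    using g unfolding set_integrable_def by (rule borel_measurable_integrable)
  have eq: "indicator (S \<inter> excision x y) t *\<^sub>R g t = indicator (excision x y) t *\<^sub>R (indicator S t *\<^sub>R g t)" for x y t
    by (simp add: indicator_inter_arith mult.commute)
  show "(\<lambda>n. LINT t:S \<inter> excision (\<alpha> (e n)) (\<beta> (e n))|lborel. g t) \<longlonglongrightarrow> (LINT t:S|lborel. g t)"
    unfolding set_lebesgue_integral_def
  proof (rule integral_dominated_convergence[where w = "\<lambda>t. norm (indicator S t *\<^sub>R g t)"])
    show "(\<lambda>t. indicator S t *\<^sub>R g t) \<in> borel_measurable lborel" by fact
    show "(\<lambda>t. indicator (S \<inter> excision (\<alpha> (e n)) (\<beta> (e n))) t *\<^sub>R g t) \<in> borel_measurable lborel" for n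
      unfolding eq using meas by measurable
    show "integrable lborel (\<lambda>t. norm (indicator S t *\<^sub>R g t))"
      using g unfolding set_integrable_def by (rule integrable_norm)
    show "AE t in lborel. norm (indicator (S \<inter> excision (\<alpha> (e n)) (\<beta> (e n))) t *\<^sub>R g t) \<le> norm (indicator S t *\<^sub>R g t)" for n
      by (intro AE_I2) (auto simp: indicator_def)
    show "AE t in lborel. (\<lambda>n. indicator (S \<inter> excision (\<alpha> (e n)) (\<beta> (e n))) t *\<^sub>R g t) \<longlonglongrightarrow> indicator S t *\<^sub>R g t"
      \<comment> \<open>Every other point eventually leaves the excised interval, and 0 alone is a
        null set.\<close>
      using AE_lborel_singleton[of 0]
    proof eventually_elim
      case (elim t)
      have "\<forall>\<^sub>F n in sequentially. t \<in> excision (\<alpha> (e n)) (\<beta> (e n))"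
      proof (cases "t < 0")
        case True
        have "\<forall>\<^sub>F n in sequentially. \<alpha> (e n) < - t"
          using True by (intro order_tendstoD(2)[OF \<alpha>]) simp
        then show ?thesis by eventually_elim simp
      next
        case False
        with elim have "\<forall>\<^sub>F n in sequentially. \<beta> (e n) < t"
          by (intro order_tendstoD(2)[OF \<beta>]) simp
        then show ?thesis by eventually_elim simp
      qed
      then have "\<forall>\<^sub>F n in sequentially. indicator S t *\<^sub>R g t = indicator (S \<inter> excision (\<alpha> (e n)) (\<beta> (e n))) t *\<^sub>R g t"
        by eventually_elim (auto simp: indicator_def)
      then show ?case
        by (rule Lim_transform_eventually[OF tendsto_const])
    qed
  qed
qed

lemma has_PV_unique: "has_PV S f v \<Longrightarrow> has_PV S f w \<Longrightarrow> v = w"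
  unfolding has_PV_def using tendsto_unique[OF trivial_limit_at_right_real] by blast

lemma PV_integral_eq: "has_PV S f v \<Longrightarrow> PV_integral S f = v"
  unfolding PV_integral_def by (rule the_equality) (auto intro: has_PV_unique)

text \<open>Subtracting \<open>1 / t\<close> near \<open>0\<close> makes the integrand of the exponential integral integrable.\<close>

definition Ei_regular :: "real \<Rightarrow> real \<Rightarrow> real" where
  "Ei_regular X t = (exp (- t) - (if \<bar>t\<bar> < X then 1 else 0)) / t"

lemma set_integrable_exp_minus: "set_integrable lborel {c<..} (\<lambda>t::real. exp (- t))"
proof -
  have "(\<lambda>t::real. exp (- 1 * t)) integrable_on {c..}"
    by (rule integrable_on_exp_minus_to_infinity) simp
  then have "(\<lambda>t::real. exp (- t)) absolutely_integrable_on {c..}"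
    by (intro nonnegative_absolutely_integrable_1) auto
  then have "set_integrable lborel {c..} (\<lambda>t::real. exp (- t))"
    unfolding set_integrable_def by (subst (asm) integrable_completion) auto
  then show ?thesis
    by (rule set_integrable_subset) auto
qed

lemma abs_exp_minus_1_le: "\<bar>exp y - 1\<bar> \<le> \<bar>y\<bar> * exp \<bar>y\<bar>" for y :: real
proof (cases "y \<ge> 0")
  case True
  have "1 - y \<le> exp (- y)" using exp_ge_add_one_self[of "- y"] by simp
  then have "(1 - y) * exp y \<le> exp (- y) * exp y" by (intro mult_right_mono) auto
  then show ?thesis using True by (simp add: algebra_simps flip: exp_add)
next
  case False
  have "1 - exp y \<le> - y" using exp_ge_add_one_self[of y] by linarith
  also have "\<dots> \<le> - y * exp (- y)" using False by (simp add: mult_le_cancel_left1)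
  finally show ?thesis using False by simp
qed

lemma set_integrable_Ei_regular:
  assumes X: "X > 0"
  shows "set_integrable lborel {- X<..} (Ei_regular X)"
proof -
  have meas [measurable]: "Ei_regular X \<in> borel_measurable borel"
    unfolding Ei_regular_def[abs_def] by measurable
  \<comment> \<open>\<open>exp (2 * X)\<close> absorbs the bound \<open>exp X\<close> near 0, where
    \<open>exp (- t)\<close> is at least \<open>exp (- X)\<close>; \<open>1 / X\<close> handles
    \<open>t >= X\<close>.\<close>
  have bound: "norm (Ei_regular X t) \<le> norm ((exp (2 * X) + 1 / X) * exp (- t))" if "t > - X" for t
  proof (cases "\<bar>t\<bar> < X")
    case True
    have "\<bar>Ei_regular X t\<bar> \<le> exp X"
    proof (cases "t = 0")
      case False
      have "\<bar>exp (- t) - 1\<bar> \<le> \<bar>t\<bar> * exp \<bar>t\<bar>" using abs_exp_minus_1_le[of "- t"] by simp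
      also have "\<dots> \<le> \<bar>t\<bar> * exp X" using True by (intro mult_left_mono) auto
      finally show ?thesis using False True by (simp add: Ei_regular_def field_simps)
    qed (simp add: Ei_regular_def)
    also have "exp X = exp (2 * X) * exp (- X)" by (simp flip: exp_add)
    also have "\<dots> \<le> (exp (2 * X) + 1 / X) * exp (- t)"
      using True X by (intro mult_mono) auto
    finally show ?thesis using X by simp
  next
    case False
    with that X have t: "t \<ge> X" by linarith
    have "\<bar>Ei_regular X t\<bar> = exp (- t) / t" using t X by (simp add: Ei_regular_def)
    also have "\<dots> \<le> exp (- t) / X" using t X by (intro divide_left_mono) auto
    also have "\<dots> \<le> (exp (2 * X) + 1 / X) * exp (- t)" by (simp add: distrib_right)
    finally show ?thesis using X by simp
  qed
  have "set_integrable lborel {- X<..} (\<lambda>t. (exp (2 * X) + 1 / X) * exp (- t))"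
    by (intro set_integrable_mult_right set_integrable_exp_minus)
  then show ?thesis
    by (rule set_integrable_bound) (use bound in \<open>auto simp: set_borel_measurable_def\<close>)
qed

text \<open>The two sides contribute \<open>ln X - ln \<beta>\<close> and
  \<open>ln \<alpha> - ln X\<close>. Only the quotient of the radii remains, so excisions with
  asymptotically equal radii give the principal value.\<close>

lemma has_bochner_integral_inverse_excision:
  assumes "0 < \<alpha>" "\<alpha> < X" "0 < \<beta>" "\<beta> < X"
  shows "has_bochner_integral lborel (\<lambda>t. indicator ({- X<..} \<inter> excision \<alpha> \<beta>) t *\<^sub>R (if \<bar>t\<bar> < X then 1 / t else 0)) (ln (\<alpha> / \<beta>))"
proof -
  have "has_bochner_integral lborel (\<lambda>t. 1 / t * indicator {\<beta>..X} t) (ln X - ln \<beta>)"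
    by (rule has_bochner_integral_FTC_Icc_real)
      (use assms in \<open>auto intro!: derivative_eq_intros continuous_intros\<close>)
  moreover have "has_bochner_integral lborel (\<lambda>t. 1 / t * indicator {- X..- \<alpha>} t) (ln (- (- \<alpha>)) - ln (- (- X)))"
    by (rule has_bochner_integral_FTC_Icc_real)
      (use assms in \<open>auto intro!: derivative_eq_intros continuous_intros\<close>)
  ultimately have "has_bochner_integral lborel (\<lambda>t. 1 / t * indicator {\<beta>..X} t + 1 / t * indicator {- X..- \<alpha>} t)
      (ln X - ln \<beta> + (ln (- (- \<alpha>)) - ln (- (- X))))"
    by (rule has_bochner_integral_add)
  also have "ln X - ln \<beta> + (ln (- (- \<alpha>)) - ln (- (- X))) = ln (\<alpha> / \<beta>)"
    using assms by (simp add: ln_div)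
  finally show ?thesis
  proof (rule has_bochner_integralI_AE)
    show "AE t in lborel. 1 / t * indicator {\<beta>..X} t + 1 / t * indicator {- X..- \<alpha>} t =
        indicator ({- X<..} \<inter> excision \<alpha> \<beta>) t *\<^sub>R (if \<bar>t\<bar> < X then 1 / t else 0)"
      using AE_lborel_singleton[of X] AE_lborel_singleton[of \<beta>] AE_lborel_singleton[of "- X"] AE_lborel_singleton[of "- \<alpha>"]
      by eventually_elim (use assms in \<open>auto simp: indicator_def\<close>)
  qed measurable
qed

lemma integral_Ei_excision:
  assumes "0 < \<alpha>" "\<alpha> < X" "0 < \<beta>" "\<beta> < X"
  shows "set_integrable lborel ({- X<..} \<inter> excision \<alpha> \<beta>) (\<lambda>t. exp (- t) / t)"
    and "(LINT t:{- X<..} \<inter> excision \<alpha> \<beta>|lborel. exp (- t) / t) =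
      (LINT t:{- X<..} \<inter> excision \<alpha> \<beta>|lborel. Ei_regular X t) + ln (\<alpha> / \<beta>)"
proof -
  define P where "P = {- X<..} \<inter> excision \<alpha> \<beta>"
  define r where "r t = (if \<bar>t\<bar> < X then 1 / t else 0)" for t
  have "set_integrable lborel P (Ei_regular X)"
    unfolding P_def by (rule set_integrable_subset[OF set_integrable_Ei_regular]) (use assms in auto)
  then have 1: "has_bochner_integral lborel (\<lambda>t. indicator P t *\<^sub>R Ei_regular X t) (LINT t:P|lborel. Ei_regular X t)"
    by (simp add: set_integrable_def set_lebesgue_integral_def has_bochner_integral_iff)
  have 2: "has_bochner_integral lborel (\<lambda>t. indicator P t *\<^sub>R r t) (ln (\<alpha> / \<beta>))"
    unfolding P_def r_def by (rule has_bochner_integral_inverse_excision[OF assms])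
  have "indicator P t *\<^sub>R Ei_regular X t + indicator P t *\<^sub>R r t = indicator P t *\<^sub>R (exp (- t) / t)" for t
    by (auto simp: Ei_regular_def r_def indicator_def diff_divide_distrib)
  with has_bochner_integral_add[OF 1 2]
  have "has_bochner_integral lborel (\<lambda>t. indicator P t *\<^sub>R (exp (- t) / t)) ((LINT t:P|lborel. Ei_regular X t) + ln (\<alpha> / \<beta>))"
    by simp
  then show "set_integrable lborel P (\<lambda>t. exp (- t) / t)"
    and "(LINT t:P|lborel. exp (- t) / t) = (LINT t:P|lborel. Ei_regular X t) + ln (\<alpha> / \<beta>)"
    by (simp_all add: set_integrable_def set_lebesgue_integral_def has_bochner_integral_iff)
qed

lemma tendsto_Ei_excision:
  fixes \<alpha> \<beta> :: "real \<Rightarrow> real"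
  assumes X: "X > 0" and \<alpha>: "(\<alpha> \<longlongrightarrow> 0) (at_right 0)" "\<forall>\<^sub>F \<epsilon> in at_right 0. \<alpha> \<epsilon> > 0"
    and \<beta>: "(\<beta> \<longlongrightarrow> 0) (at_right 0)" "\<forall>\<^sub>F \<epsilon> in at_right 0. \<beta> \<epsilon> > 0"
    and quot: "((\<lambda>\<epsilon>. \<alpha> \<epsilon> / \<beta> \<epsilon>) \<longlongrightarrow> 1) (at_right 0)"
  shows "((\<lambda>\<epsilon>. LINT t:{- X<..} \<inter> excision (\<alpha> \<epsilon>) (\<beta> \<epsilon>)|lborel. exp (- t) / t) \<longlongrightarrow>
    (LINT t:{- X<..}|lborel. Ei_regular X t)) (at_right 0)"
proof -
  have "((\<lambda>\<epsilon>. (LINT t:{- X<..} \<inter> excision (\<alpha> \<epsilon>) (\<beta> \<epsilon>)|lborel. Ei_regular X t) + ln (\<alpha> \<epsilon> / \<beta> \<epsilon>)) \<longlongrightarrow>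
      (LINT t:{- X<..}|lborel. Ei_regular X t) + ln 1) (at_right 0)"
    by (intro tendsto_intros tendsto_integral_excision set_integrable_Ei_regular X \<alpha>(1) \<beta>(1) quot) auto
  then show ?thesis
    unfolding ln_one add_0_right
  proof (rule Lim_transform_eventually)
    show "\<forall>\<^sub>F \<epsilon> in at_right 0. (LINT t:{- X<..} \<inter> excision (\<alpha> \<epsilon>) (\<beta> \<epsilon>)|lborel. Ei_regular X t) + ln (\<alpha> \<epsilon> / \<beta> \<epsilon>) =
        (LINT t:{- X<..} \<inter> excision (\<alpha> \<epsilon>) (\<beta> \<epsilon>)|lborel. exp (- t) / t)"
      using \<alpha>(2) \<beta>(2) order_tendstoD(2)[OF \<alpha>(1) X] order_tendstoD(2)[OF \<beta>(1) X]
      by eventually_elim (simp add: integral_Ei_excision)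
  qed
qed

lemma has_PV_Ei:
  assumes X: "X > 0"
  shows "has_PV {- X..} (\<lambda>t. exp (- t) / t) (LINT t:{- X<..}|lborel. Ei_regular X t)"
  unfolding has_PV_def abs_greater_eq_excision
proof (intro conjI allI impI)
  fix \<epsilon> :: real assume \<epsilon>: "\<epsilon> > 0"
  show "set_integrable lborel ({- X..} \<inter> excision \<epsilon> \<epsilon>) (\<lambda>t. exp (- t) / t)"
  proof (rule set_integrable_bound)
    have "set_integrable lborel ({- X..} \<inter> excision \<epsilon> \<epsilon>) (\<lambda>t. exp (- t))"
      by (rule set_integrable_subset[OF set_integrable_exp_minus[of "- X - 1"]]) auto
    then show "set_integrable lborel ({- X..} \<inter> excision \<epsilon> \<epsilon>) (\<lambda>t. 1 / \<epsilon> * exp (- t))"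
      by (rule set_integrable_mult_right)
    show "AE t in lborel. t \<in> {- X..} \<inter> excision \<epsilon> \<epsilon> \<longrightarrow> norm (exp (- t) / t) \<le> norm (1 / \<epsilon> * exp (- t))"
    proof (intro AE_I2 impI)
      fix t assume "t \<in> {- X..} \<inter> excision \<epsilon> \<epsilon>"
      then have "\<epsilon> \<le> \<bar>t\<bar>" by auto
      then have "exp (- t) / \<bar>t\<bar> \<le> exp (- t) / \<epsilon>"
        using \<epsilon> by (intro divide_left_mono) auto
      then show "norm (exp (- t) / t) \<le> norm (1 / \<epsilon> * exp (- t))"
        using \<epsilon> by (simp add: abs_divide)
    qed
  qed (simp add: set_borel_measurable_def)
next
  \<comment> \<open>The closed ray in the definition of \<open>Ei\<close> and the open one, which is
    the range of the substitution, differ by a null set.\<close>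
  have "(LINT t:{- X..} \<inter> excision \<epsilon> \<epsilon>|lborel. exp (- t) / t) = (LINT t:{- X<..} \<inter> excision \<epsilon> \<epsilon>|lborel. exp (- t) / t)" for \<epsilon>
    unfolding set_lebesgue_integral_def
  proof (rule integral_cong_AE)
    show "AE t in lborel. indicator ({- X..} \<inter> excision \<epsilon> \<epsilon>) t *\<^sub>R (exp (- t) / t) =
        indicator ({- X<..} \<inter> excision \<epsilon> \<epsilon>) t *\<^sub>R (exp (- t) / t)"
      using AE_lborel_singleton[of "- X"] by eventually_elim (auto simp: indicator_def)
  qed measurable
  moreover have "((\<lambda>\<epsilon>. LINT t:{- X<..} \<inter> excision \<epsilon> \<epsilon>|lborel. exp (- t) / t) \<longlongrightarrow>
      (LINT t:{- X<..}|lborel. Ei_regular X t)) (at_right 0)"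
  proof (rule tendsto_Ei_excision[OF X])
    show "((\<lambda>\<epsilon>::real. \<epsilon> / \<epsilon>) \<longlongrightarrow> 1) (at_right 0)"
      by (rule Lim_transform_eventually[OF tendsto_const])
        (auto simp: eventually_at_filter)
  qed (auto simp: eventually_at_right_less)
  ultimately show "((\<lambda>\<epsilon>. LINT t:{- X..} \<inter> excision \<epsilon> \<epsilon>|lborel. exp (- t) / t) \<longlongrightarrow>
      (LINT t:{- X<..}|lborel. Ei_regular X t)) (at_right 0)"
    by simp
qed

lemma Ei_eq: "X > 0 \<Longrightarrow> Ei X = - (LINT t:{- X<..}|lborel. Ei_regular X t)"
  unfolding Ei_def by (simp add: PV_integral_eq[OF has_PV_Ei])

section \<open>The selector integral\<close>

lemma abs_one_minus_exp_ge:
  fixes u :: real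
  assumes "\<bar>u\<bar> > \<epsilon>" "\<epsilon> > 0"
  shows "\<bar>1 - exp u\<bar> \<ge> 1 - exp (- \<epsilon>)"
proof (cases "u > 0")
  case True
  have "(1 - exp (- \<epsilon>)) * 1 \<le> (1 - exp (- \<epsilon>)) * exp \<epsilon>"
    using assms by (intro mult_left_mono) auto
  also have "\<dots> = exp \<epsilon> - 1" by (simp add: algebra_simps flip: exp_add)
  also have "\<dots> \<le> exp u - 1" using True assms by simp
  finally show ?thesis using True by simp
next
  case False
  then have "exp u \<le> exp (- \<epsilon>)" using assms by simp
  then show ?thesis using abs_ge_self[of "1 - exp u"] by linarith
qed

definition selector_integrand :: "real \<Rightarrow> nat \<Rightarrow> real \<Rightarrow> real" where
  "selector_integrand a N u = gamma_kernel a u * exp (real N * u) / (1 - exp u)"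

lemma set_integrable_selector_integrand:
  assumes a: "a > 0" and \<epsilon>: "\<epsilon> > 0"
  shows "set_integrable lborel (excision \<epsilon> \<epsilon>) (selector_integrand a N)"
proof (rule set_integrable_bound)
  have "integrable lborel (\<lambda>u. gamma_kernel a u * exp (real N * u))"
    using gamma_kernel_moment[OF a] by (rule integrable.intros)
  then have "set_integrable lborel UNIV (\<lambda>u. gamma_kernel a u * exp (real N * u))"
    by (simp add: set_integrable_def)
  then show "set_integrable lborel (excision \<epsilon> \<epsilon>) (\<lambda>u. gamma_kernel a u * exp (real N * u) / (1 - exp (- \<epsilon>)))"
    by (intro set_integrable_divide) (rule set_integrable_subset, auto)
  show "set_borel_measurable lborel (excision \<epsilon> \<epsilon>) (selector_integrand a N)"
    unfolding set_borel_measurable_def selector_integrand_def[abs_def] gamma_kernel_def[abs_def] by measurable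
  show "AE u in lborel. u \<in> excision \<epsilon> \<epsilon> \<longrightarrow> norm (selector_integrand a N u) \<le>
      norm (gamma_kernel a u * exp (real N * u) / (1 - exp (- \<epsilon>)))"
  proof (intro AE_I2 impI)
    fix u assume "u \<in> excision \<epsilon> \<epsilon>"
    then have "1 - exp (- \<epsilon>) \<le> \<bar>1 - exp u\<bar>"
      using \<epsilon> by (intro abs_one_minus_exp_ge) auto
    moreover have "gamma_kernel a u \<ge> 0" by (simp add: gamma_kernel_def)
    moreover have "0 < 1 - exp (- \<epsilon>)" using \<epsilon> by simp
    moreover from calculation have "0 < \<bar>1 - exp u\<bar>" by linarith
    ultimately have "gamma_kernel a u * exp (real N * u) / \<bar>1 - exp u\<bar> \<le> gamma_kernel a u * exp (real N * u) / (1 - exp (- \<epsilon>))"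
      by (intro divide_left_mono mult_pos_pos mult_nonneg_nonneg) simp_all
    then show "norm (selector_integrand a N u) \<le> norm (gamma_kernel a u * exp (real N * u) / (1 - exp (- \<epsilon>)))"
      using \<open>gamma_kernel a u \<ge> 0\<close> \<open>0 < 1 - exp (- \<epsilon>)\<close>
      by (simp add: selector_integrand_def abs_mult abs_divide)
  qed
qed

text \<open>The substitution \<open>t = (exp u - 1) / a\<close> turns the excision symmetric in \<open>u\<close> into one that is
  only asymptotically symmetric in \<open>t\<close>.\<close>

lemma integral_selector_integrand_0:
  assumes a: "a > 0" and \<epsilon>: "\<epsilon> > 0" "exp \<epsilon> < 2"
  shows "(LINT u:excision \<epsilon> \<epsilon>|lborel. selector_integrand a 0 u) = - (exp (- 1 / a) / a) *
    (LINT t:{- (1 / a)<..} \<inter> excision ((1 - exp (- \<epsilon>)) / a) ((exp \<epsilon> - 1) / a)|lborel. exp (- t) / t)"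
proof -
  define P where "P = {- (1 / a)<..} \<inter> excision ((1 - exp (- \<epsilon>)) / a) ((exp \<epsilon> - 1) / a)"
  define S where "S = excision \<epsilon> \<epsilon>"
  define g where "g u = (exp u - 1) / a" for u
  define f where "f t = exp (- t) / t" for t :: real
  \<comment> \<open>\<open>exp \<epsilon> < 2\<close> keeps the right radius
    \<open>(exp \<epsilon> - 1) / a\<close> below \<open>1 / a\<close>.\<close>
  have intP: "set_integrable lborel P f"
    unfolding P_def f_def
    by (rule integral_Ei_excision) (use a \<epsilon> in \<open>auto simp: divide_strict_right_mono\<close>)
  have image: "g ` S = P"
  proof (intro equalityI subsetI)
    fix t assume "t \<in> g ` S"
    then show "t \<in> P"
      using a by (auto simp: S_def P_def g_def divide_strict_right_mono field_simps)
  next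
    fix t assume t: "t \<in> P"
    then have pos: "1 + a * t > 0" using a by (auto simp: P_def field_simps)
    have "ln (1 + a * t) \<in> S"
    proof (cases "t < - ((1 - exp (- \<epsilon>)) / a)")
      case True
      then have "1 + a * t < exp (- \<epsilon>)" using a by (simp add: field_simps)
      then have "ln (1 + a * t) < - \<epsilon>" using pos by (metis ln_exp ln_less_cancel_iff exp_gt_zero)
      then show ?thesis by (simp add: S_def)
    next
      case False
      with t have "t > (exp \<epsilon> - 1) / a" by (simp add: P_def)
      then have "exp \<epsilon> < 1 + a * t" using a by (simp add: field_simps)
      then have "\<epsilon> < ln (1 + a * t)" using pos by (metis ln_exp ln_less_cancel_iff exp_gt_zero)
      then show ?thesis by (simp add: S_def)
    qed
    moreover have "g (ln (1 + a * t)) = t" using pos a by (simp add: g_def)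
    ultimately show "t \<in> g ` S" by (metis image_eqI)
  qed
  have eq: "\<bar>exp u / a\<bar> * f (g u) = - (a * exp (1 / a)) * selector_integrand a 0 u" for u
  proof -
    \<comment> \<open>The \<open>- 1\<close> in the substitution is the origin of the factor
      \<open>exp (- 1 / a)\<close> in the value.\<close>
    have 1: "exp (- ((exp u - 1) / a)) = exp (1 / a) * exp (- (exp u / a))"
      by (simp add: diff_divide_distrib flip: exp_add)
    have 2: "gamma_kernel a u = exp u / a * exp (- (exp u / a))"
      using a by (simp add: gamma_kernel_def exp_diff)
    \<comment> \<open>\<open>e = 1\<close> corresponds to \<open>u = 0\<close>, where both sides are
      0 because division by 0 yields 0.\<close>
    have "e / a * (c * d / ((e - 1) / a)) = - (a * c) * (e / a * d / (1 - e))" for c d e :: real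
      using a by (cases "e = 1") (simp_all add: divide_simps, simp add: algebra_simps)
    then show ?thesis
      using a by (simp add: f_def g_def selector_integrand_def 1 2)
  qed
  have "(\<lambda>u. \<bar>exp u / a\<bar> * f (g u)) absolutely_integrable_on S \<and>
      integral S (\<lambda>u. \<bar>exp u / a\<bar> * f (g u)) = (LINT t:P|lborel. f t) \<longleftrightarrow>
      f absolutely_integrable_on (g ` S) \<and> integral (g ` S) f = (LINT t:P|lborel. f t)"
  proof (rule has_absolute_integral_change_of_variables_1')
    show "S \<in> sets lebesgue" unfolding S_def using excision_sets by (intro sets_completionI_sets) simp
    show "(g has_field_derivative exp u / a) (at u within S)" for u
      unfolding g_def using a by (auto intro!: derivative_eq_intros)
    show "inj_on g S" using a by (auto simp: inj_on_def g_def)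
  qed
  moreover have "f absolutely_integrable_on P"
  proof -
    have "f \<in> borel_measurable borel" unfolding f_def[abs_def] by measurable
    then show ?thesis
      using intP unfolding set_integrable_def by (subst integrable_completion) (auto simp: P_def)
  qed
  moreover have "integral P f = (LINT t:P|lborel. f t)"
    using set_borel_integral_eq_integral(2)[OF intP] by simp
  ultimately have "integral S (\<lambda>u. - (a * exp (1 / a)) * selector_integrand a 0 u) = (LINT t:P|lborel. f t)"
    unfolding image eq by blast
  moreover have "set_integrable lborel S (\<lambda>u. - (a * exp (1 / a)) * selector_integrand a 0 u)"
    unfolding S_def by (intro set_integrable_mult_right set_integrable_selector_integrand a \<epsilon>(1))
  ultimately have "(LINT u:S|lborel. - (a * exp (1 / a)) * selector_integrand a 0 u) = (LINT t:P|lborel. f t)"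
    using set_borel_integral_eq_integral(2) by metis
  then have scaled: "- (a * exp (1 / a)) * (LINT u:S|lborel. selector_integrand a 0 u) = (LINT t:P|lborel. f t)"
    by (simp only: set_integral_mult_right)
  have "- (exp (- 1 / a) / a) * (LINT t:P|lborel. f t) = (exp (- 1 / a) * exp (1 / a)) * (LINT u:S|lborel. selector_integrand a 0 u)"
    using a by (simp flip: scaled)
  also have "exp (- 1 / a) * exp (1 / a) = 1" by (simp flip: exp_add)
  finally show ?thesis by (simp add: P_def S_def f_def)
qed

lemma tendsto_integral_selector_integrand_0:
  assumes a: "a > 0"
  shows "((\<lambda>\<epsilon>. LINT u:excision \<epsilon> \<epsilon>|lborel. selector_integrand a 0 u) \<longlongrightarrow> exp (- 1 / a) / a * Ei (1 / a)) (at_right 0)"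
proof -
  have "((\<lambda>\<epsilon>. - (exp (- 1 / a) / a) *
      (LINT t:{- (1 / a)<..} \<inter> excision ((1 - exp (- \<epsilon>)) / a) ((exp \<epsilon> - 1) / a)|lborel. exp (- t) / t)) \<longlongrightarrow>
      - (exp (- 1 / a) / a) * (LINT t:{- (1 / a)<..}|lborel. Ei_regular (1 / a) t)) (at_right 0)"
  proof (intro tendsto_mult tendsto_const tendsto_Ei_excision)
    show "((\<lambda>\<epsilon>. (1 - exp (- \<epsilon>)) / a) \<longlongrightarrow> 0) (at_right 0)" "((\<lambda>\<epsilon>. (exp \<epsilon> - 1) / a) \<longlongrightarrow> 0) (at_right 0)"
      using a by (auto intro!: tendsto_eq_intros)
    show "\<forall>\<^sub>F \<epsilon> in at_right 0. 0 < (1 - exp (- \<epsilon>)) / a" "\<forall>\<^sub>F \<epsilon> in at_right 0. 0 < (exp \<epsilon> - 1) / a"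
      using a by (auto simp: eventually_at_filter)
    \<comment> \<open>The quotient of the two radii is exactly
      \<open>exp (- \<epsilon>)\<close>.\<close>
    have "((\<lambda>\<epsilon>::real. exp (- \<epsilon>)) \<longlongrightarrow> 1) (at_right 0)"
      by (auto intro!: tendsto_eq_intros)
    moreover have "\<forall>\<^sub>F \<epsilon> in at_right 0. exp (- \<epsilon>) = (1 - exp (- \<epsilon>)) / a / ((exp \<epsilon> - 1) / a)"
    proof -
      have "exp (- \<epsilon>) = (1 - exp (- \<epsilon>)) / a / ((exp \<epsilon> - 1) / a)" if "\<epsilon> > 0" for \<epsilon> :: real
      proof -
        have "exp (- \<epsilon>) * (exp \<epsilon> - 1) = 1 - exp (- \<epsilon>)" by (simp add: algebra_simps flip: exp_add)
        then show ?thesis using that a by (simp add: divide_simps)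
      qed
      then show ?thesis by (auto simp: eventually_at_filter)
    qed
    ultimately show "((\<lambda>\<epsilon>. (1 - exp (- \<epsilon>)) / a / ((exp \<epsilon> - 1) / a)) \<longlongrightarrow> 1) (at_right 0)"
      by (rule Lim_transform_eventually)
  qed (use a in simp)
  then show ?thesis
  proof (rule Lim_transform_eventually[THEN tendsto_eq_rhs])
    have "\<forall>\<^sub>F \<epsilon>::real in at_right 0. \<epsilon> < ln 2"
      by (rule order_tendstoD(2)[OF tendsto_ident_at]) simp
    then show "\<forall>\<^sub>F \<epsilon> in at_right 0. - (exp (- 1 / a) / a) *
        (LINT t:{- (1 / a)<..} \<inter> excision ((1 - exp (- \<epsilon>)) / a) ((exp \<epsilon> - 1) / a)|lborel. exp (- t) / t) =
        (LINT u:excision \<epsilon> \<epsilon>|lborel. selector_integrand a 0 u)"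
      using eventually_at_right_less[of 0]
    proof eventually_elim
      case (elim \<epsilon>)
      then have "exp \<epsilon> < 2" by (metis exp_less_cancel_iff exp_ln zero_less_numeral)
      with elim show ?case by (intro integral_selector_integrand_0[OF a, symmetric])
    qed
    show "- (exp (- 1 / a) / a) * (LINT t:{- (1 / a)<..}|lborel. Ei_regular (1 / a) t) = exp (- 1 / a) / a * Ei (1 / a)"
      using a by (simp add: Ei_eq)
  qed
qed

text \<open>The substitution is carried out only for \<open>N = 0\<close>; each induction step
  subtracts an absolutely convergent integral, so that the existence of the limit is inherited
  together with its value.\<close>

lemma tendsto_integral_selector_integrand:
  assumes a: "a > 0"
  shows "((\<lambda>\<epsilon>. LINT u:excision \<epsilon> \<epsilon>|lborel. selector_integrand a N u) \<longlongrightarrow>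
    exp (- 1 / a) / a * Ei (1 / a) - (\<Sum>k<N. fact k * a ^ k)) (at_right 0)"
proof (induction N)
  case 0
  then show ?case using tendsto_integral_selector_integrand_0[OF a] by simp
next
  case (Suc N)
  define m where "m u = gamma_kernel a u * exp (real N * u)" for u
  have m: "set_integrable lborel UNIV m" "(LINT u:UNIV|lborel. m u) = fact N * a ^ N"
    using gamma_kernel_moment[OF a, of N]
    by (simp_all add: m_def[abs_def] set_integrable_def set_lebesgue_integral_def has_bochner_integral_iff)
  have "((\<lambda>\<epsilon>. LINT u:UNIV \<inter> excision \<epsilon> \<epsilon>|lborel. m u) \<longlongrightarrow> (LINT u:UNIV|lborel. m u)) (at_right 0)"
    by (rule tendsto_integral_excision[OF m(1)]) (auto intro: tendsto_ident_at)
  from tendsto_diff[OF Suc this]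
  have "((\<lambda>\<epsilon>. (LINT u:excision \<epsilon> \<epsilon>|lborel. selector_integrand a N u) - (LINT u:excision \<epsilon> \<epsilon>|lborel. m u)) \<longlongrightarrow>
      exp (- 1 / a) / a * Ei (1 / a) - (\<Sum>k<Suc N. fact k * a ^ k)) (at_right 0)"
    unfolding m(2) by (simp add: diff_diff_eq)
  moreover have "\<forall>\<^sub>F \<epsilon> in at_right 0. (LINT u:excision \<epsilon> \<epsilon>|lborel. selector_integrand a N u) - (LINT u:excision \<epsilon> \<epsilon>|lborel. m u) =
      (LINT u:excision \<epsilon> \<epsilon>|lborel. selector_integrand a (Suc N) u)"
    using eventually_at_right_less[of 0]
  proof eventually_elim
    case (elim \<epsilon>)
    have "set_integrable lborel (excision \<epsilon> \<epsilon>) m"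
      by (rule set_integrable_subset[OF m(1)]) auto
    then have "(LINT u:excision \<epsilon> \<epsilon>|lborel. selector_integrand a N u) - (LINT u:excision \<epsilon> \<epsilon>|lborel. m u) =
        (LINT u:excision \<epsilon> \<epsilon>|lborel. selector_integrand a N u - m u)"
      using set_integrable_selector_integrand[OF a elim] by (intro set_integral_diff(2)[symmetric])
    also have "\<dots> = (LINT u:excision \<epsilon> \<epsilon>|lborel. selector_integrand a (Suc N) u)"
    proof (rule set_lebesgue_integral_cong)
      show "\<forall>u. u \<in> excision \<epsilon> \<epsilon> \<longrightarrow> selector_integrand a N u - m u = selector_integrand a (Suc N) u"
      proof (intro allI impI)
        fix u assume "u \<in> excision \<epsilon> \<epsilon>"
        then have "1 - exp u \<noteq> 0" using elim by auto
        then have "selector_integrand a N u - m u = (m u - m u * (1 - exp u)) / (1 - exp u)"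
          by (simp add: selector_integrand_def m_def diff_divide_distrib)
        also have "m u - m u * (1 - exp u) = gamma_kernel a u * exp (real (Suc N) * u)"
          by (simp add: m_def algebra_simps exp_add)
        finally show "selector_integrand a N u - m u = selector_integrand a (Suc N) u"
          by (simp add: selector_integrand_def)
      qed
    qed simp
    finally show ?case .
  qed
  ultimately show ?case by (rule Lim_transform_eventually)
qed

lemma has_PV_selector_integrand:
  assumes a: "a > 0"
  shows "has_PV UNIV (\<lambda>u. complex_of_real (selector_integrand a N u))
    (of_real (exp (- 1 / a) / a * Ei (1 / a) - (\<Sum>k<N. fact k * a ^ k)))"
  unfolding has_PV_def abs_greater_eq_excision Int_UNIV_left
proof (intro conjI allI impI)
  fix \<epsilon> :: real assume "\<epsilon> > 0"
  from set_integrable_selector_integrand[OF a this, of N, unfolded set_integrable_def]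
  have "integrable lborel (\<lambda>u. complex_of_real (indicator (excision \<epsilon> \<epsilon>) u *\<^sub>R selector_integrand a N u))"
    by (rule integrable_of_real)
  then show "set_integrable lborel (excision \<epsilon> \<epsilon>) (\<lambda>u. complex_of_real (selector_integrand a N u))"
    by (simp add: set_integrable_def scaleR_conv_of_real)
next
  show "((\<lambda>\<epsilon>. LINT u:excision \<epsilon> \<epsilon>|lborel. complex_of_real (selector_integrand a N u)) \<longlongrightarrow>
      of_real (exp (- 1 / a) / a * Ei (1 / a) - (\<Sum>k<N. fact k * a ^ k))) (at_right 0)"
    unfolding set_integral_complex_of_real
    by (intro tendsto_of_real tendsto_integral_selector_integrand a)
qed


section \<open>The selector and the C-sum\<close>

lemma plus_integrand_gamma_monomial:
  assumes "\<forall>z. Re z \<ge> x0 \<longrightarrow> lcont H z = 1"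
  shows "plus_integrand [(1, gamma_monomial a H)] N = (\<lambda>u. of_real (selector_integrand a N u))"
  by (rule ext) (simp add: plus_integrand_def bromwich_gamma_monomial[OF assms] selector_integrand_def)

lemma S_plus_gamma_monomial:
  assumes "a > 0" "\<forall>z. Re z \<ge> x0 \<longrightarrow> lcont H z = 1"
  shows "S_plus [(1, gamma_monomial a H)] N =
    of_real (exp (- 1 / a) / a * Ei (1 / a) - (\<Sum>k<N. fact k * a ^ k))"
  unfolding S_plus_def plus_integrand_gamma_monomial[OF assms(2)]
  by (rule PV_integral_eq[OF has_PV_selector_integrand[OF assms(1)]])

lemma bromwich_line_Nil [simp]: "bromwich_line [] \<sigma> u = 0"
  by (simp add: bromwich_line_def bromwich_integrand_def fcont_def)

lemma bromwich_Nil [simp]: "bromwich [] u = 0"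
  unfolding bromwich_def by (rule the_equality) auto

lemma minus_integrand_Nil [simp]: "minus_integrand [] N u = 0"
  by (simp add: minus_integrand_def)

lemma S_minus_Nil [simp]: "S_minus [] N = 0"
  by (simp add: S_minus_def)

lemma bromwich_admissible_Nil: "bromwich_admissible []"
  by (simp add: bromwich_admissible_def mflat_def bromwich_integrand_def[abs_def] fcont_def)

lemma plus_part_gamma_monomial [simp]: "plus_part [(1, 0, M)] = [(1, M)]"
  and minus_part_gamma_monomial [simp]: "minus_part [(1, 0, M)] = []"
  by (simp_all add: plus_part_def minus_part_def)

text \<open>Here the germ of \<open>H\<close> is turned into its continuation; the value is the same
  for every expression of 1, which makes the finite part well defined.\<close>

lemma selector_gamma_monomial:
  assumes "a > 0" "H \<in> logexp" "\<forall>\<^sub>F x in at_top. lval H x = 1"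
  shows "selector [(1, 0, gamma_monomial a H)] N =
    of_real (exp (- 1 / a) / a * Ei (1 / a) - (\<Sum>k<N. fact k * a ^ k))"
proof -
  obtain x0 where x0: "\<forall>z. Re z \<ge> x0 \<longrightarrow> lcont H z = 1"
    using lcont_logexp_eventually_1[OF assms(2,3)] by blast
  show ?thesis
    by (simp only: selector_def plus_part_gamma_monomial minus_part_gamma_monomial
        S_plus_gamma_monomial[OF assms(1) x0] S_minus_Nil mult_zero_right add_0_right)
qed

section \<open>Shift-nonresonance of the selector\<close>

lemma fact_power_dominates:
  fixes a :: real and U :: "nat \<Rightarrow> real"
  assumes a: "a > 0" and U: "\<And>N. \<bar>U (Suc N)\<bar> \<le> \<bar>U N\<bar> + fact N * a ^ N"
  shows "\<exists>K>0. \<exists>N0. \<forall>N\<ge>N0. \<bar>U N\<bar> \<le> K * (fact N * a ^ N)"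
proof -
  define s where "s N = fact N * a ^ N" for N
  have s: "s N > 0" for N using a by (simp add: s_def)
  have s_Suc: "s (Suc N) = real (Suc N) * a * s N" for N
    by (simp add: s_def)
  \<comment> \<open>From \<open>N0\<close> on, the sequence \<open>s\<close> at least doubles in
    each step.\<close>
  obtain N0 where N0: "2 / a < real N0" using reals_Archimedean2 by blast
  \<comment> \<open>\<open>K >= 1\<close> bounds the added term \<open>s N\<close> by
    \<open>K * s N\<close>, and doubling absorbs the sum; the quotient serves the base case.\<close>
  define K where "K = max 1 (\<bar>U N0\<bar> / s N0)"
  have "\<bar>U N\<bar> \<le> K * s N" if "N \<ge> N0" for N
    using that
  proof (induction N rule: dec_induct)
    case base
    have "\<bar>U N0\<bar> / s N0 \<le> K" by (simp add: K_def)
    then show ?case using s[of N0] by (simp add: field_simps)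
  next
    case (step N)
    have "2 / a < real (Suc N)" using N0 step.hyps by linarith
    then have two: "2 \<le> real (Suc N) * a" using a by (simp add: field_simps)
    have "\<bar>U (Suc N)\<bar> \<le> K * s N + s N"
      using U[of N] step.IH by (simp add: s_def)
    also have "\<dots> \<le> K * s N + K * s N"
      using s[of N] by (simp add: K_def)
    also have "\<dots> = K * (2 * s N)" by simp
    also have "\<dots> \<le> K * (real (Suc N) * a * s N)"
      using two s[of N] by (intro mult_left_mono mult_right_mono) (auto simp: K_def)
    finally show ?case by (simp only: s_Suc)
  qed
  moreover have "K > 0" by (simp add: K_def)
  ultimately show ?thesis unfolding s_def by blast
qed

text \<open>The difference of consecutive values is the next summand, which dominates
  \<open>U N\<close> because factorials outgrow geometric sequences; the domination constant
  \<open>K\<close> gives \<open>\<epsilon> = 1 / K\<close>.\<close>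

lemma shift_nonresonant_fact_power:
  assumes a: "a > 0" and U: "\<And>N. U N = complex_of_real (C - (\<Sum>k<N. fact k * a ^ k))"
  shows "shift_nonresonant U"
proof -
  define u where "u N = C - (\<Sum>k<N. fact k * a ^ k)" for N
  have diff: "u N - u (Suc N) = fact N * a ^ N" for N by (simp add: u_def)
  have "\<bar>u (Suc N)\<bar> \<le> \<bar>u N\<bar> + fact N * a ^ N" for N
  proof -
    have "u (Suc N) = u N - fact N * a ^ N" using diff[of N] by linarith
    moreover have "0 \<le> fact N * a ^ N" using a by simp
    ultimately show ?thesis by linarith
  qed
  from fact_power_dominates[OF a this]
  obtain K N0 where K: "K > 0" "\<And>N. N \<ge> N0 \<Longrightarrow> \<bar>u N\<bar> \<le> K * (fact N * a ^ N)"
    by blast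
  have "norm (U N - U (Suc N)) \<ge> 1 / K * norm (U N)" if "N \<ge> N0" for N
  proof -
    have "U N - U (Suc N) = of_real (fact N * a ^ N)"
      unfolding U u_def[symmetric] of_real_diff[symmetric] diff ..
    then have "norm (U N - U (Suc N)) = fact N * a ^ N"
      using a by (simp only: norm_of_real) simp
    moreover have "norm (U N) = \<bar>u N\<bar>" unfolding U u_def[symmetric] by (rule norm_of_real)
    ultimately show ?thesis using K(2)[OF that] K(1) by (simp add: field_simps)
  qed
  then show ?thesis
    unfolding shift_nonresonant_def using K(1) by (intro disjI2 exI[of _ "1 / K"]) auto
qed

lemma M_interpolant_gamma_monomial:
  assumes a: "a > 0" and R: "\<And>N. R N - R (Suc N) = complex_of_real (fact N * a ^ N)"
  shows "M_interpolant R [(1, 0, gamma_monomial a const_1)]"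
  unfolding M_interpolant_def
proof (intro conjI)
  have const: "\<forall>z. Re z \<ge> 0 \<longrightarrow> lcont const_1 z = 1" by simp
  show "[(1, 0, gamma_monomial a const_1)] \<in> mspace"
    by (simp add: mspace_def)
  show "\<forall>\<^sub>F N in sequentially. mval [(1, 0, gamma_monomial a const_1)] (real N) = R N - R (Suc N)"
    by (intro always_eventually allI) (simp add: mval_def gval_gamma_monomial_of_nat[OF a] R)
  show "admits_selector [(1, 0, gamma_monomial a const_1)]"
    unfolding admits_selector_def plus_part_gamma_monomial minus_part_gamma_monomial
  proof (intro conjI bromwich_admissible_gamma_monomial[OF a] bromwich_admissible_Nil always_eventually allI)
    fix N
    show "\<exists>v. has_PV UNIV (plus_integrand [(1, gamma_monomial a const_1)] N) v"
      unfolding plus_integrand_gamma_monomial[OF const] using has_PV_selector_integrand[OF a] by blast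
    have "minus_integrand [] N = (\<lambda>_. 0)"
      by (rule ext) simp
    then show "integrable lborel (minus_integrand [] N)"
      by simp
  qed
  show "shift_nonresonant (selector [(1, 0, gamma_monomial a const_1)])"
    by (rule shift_nonresonant_fact_power[OF a], rule selector_gamma_monomial[OF a])
      (simp_all add: const_1_def)
qed

text \<open>\<open>has_FP\<close> admits any interpolant, so its uniqueness up to expressions
  enters. The partial sums in \<open>R N\<close> and in the selector then cancel, which makes the
  difference constant.\<close>

lemma FP_infinity_fact_power:
  assumes a: "a > 0" and R: "\<And>N. R N - R (Suc N) = complex_of_real (fact N * a ^ N)"
  shows "M_admissible R" and "FP_infinity R = R 0 - of_real (exp (- 1 / a) / a * Ei (1 / a))"
proof -
  define v where "v = complex_of_real (exp (- 1 / a) / a * Ei (1 / a))"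
  note interp = M_interpolant_gamma_monomial[of a R, OF a R]
  then show "M_admissible R" unfolding M_admissible_def by blast
  \<comment> \<open>All terms are positive, so \<open>has_FP\<close> takes its second
    branch.\<close>
  have ne: "\<not> (\<forall>\<^sub>F N in sequentially. R N - R (Suc N) = 0)"
    using a eventually_happens'[OF sequentially_bot] by (fastforce simp: R)
  have R_eq: "R N = R 0 - of_real (\<Sum>k<N. fact k * a ^ k)" for N
  proof (induction N)
    case (Suc N)
    have "R (Suc N) = R N - of_real (fact N * a ^ N)" using R[of N] by (simp add: algebra_simps)
    then show ?case unfolding Suc.IH by simp
  qed simp
  have selector: "R N - selector c N = R 0 - v" if c: "M_interpolant R c" for c N
  proof -
    have "c \<in> mspace" "\<forall>\<^sub>F N in sequentially. mval c (real N) = of_real (fact N * a ^ N)"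
      using c by (simp_all add: M_interpolant_def R)
    from interpolant_fact_power_unique[OF a this] obtain H
      where H: "H \<in> logexp" "c = [(1, 0, gamma_monomial a H)]" "\<forall>\<^sub>F x in at_top. lval H x = 1"
      by blast
    show ?thesis
      unfolding H(2) selector_gamma_monomial[OF a H(1,3)] R_eq[of N] v_def by simp
  qed
  have "FP_infinity R = R 0 - v"
    unfolding FP_infinity_def
  proof (rule the_equality)
    show "has_FP R (R 0 - v)"
      using ne interp selector by (auto simp: has_FP_def)
    fix w assume "has_FP R w"
    then obtain c where "M_interpolant R c" "\<forall>\<^sub>F N in sequentially. R N - selector c N = w"
      using ne by (auto simp: has_FP_def)
    with selector have "\<forall>\<^sub>F N::nat in sequentially. R 0 - v = w" by simp
    then show "w = R 0 - v" by simp
  qed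
  then show "FP_infinity R = R 0 - of_real (exp (- 1 / a) / a * Ei (1 / a))" by (simp add: v_def)
qed

section \<open>Recurrence presentations\<close>

lemma normalized_tail_diff:
  assumes "recurrence_presentation s n\<^sub>0 a b \<mu>" "recurrence_solution n\<^sub>0 a b \<mu> I"
  shows "normalized_tail n\<^sub>0 a b I N - normalized_tail n\<^sub>0 a b I (Suc N) = s N"
    and "normalized_tail n\<^sub>0 a b I 0 = a n\<^sub>0 * I n\<^sub>0"
proof -
  define P where "P = recurrence_prod a b (n\<^sub>0 + N) n\<^sub>0"
  define m where "m = n\<^sub>0 + N"
  have nz: "a n \<noteq> 0" "b n \<noteq> 0" if "n \<ge> n\<^sub>0" for n
    using assms(1) that by (auto simp: recurrence_presentation_def)
  have P_Suc: "recurrence_prod a b (n\<^sub>0 + Suc N) n\<^sub>0 = P * (- a m / b m)"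
    by (simp add: P_def m_def recurrence_prod_def)
  have m: "m \<ge> n\<^sub>0" by (simp add: m_def)
  have P0: "P \<noteq> 0" using nz by (auto simp: P_def recurrence_prod_def)
  \<comment> \<open>\<open>recurrence_prod\<close> inverts the product in the presentation up to
    sign and the shift of \<open>a\<close> by one index, which leaves the two end factors.\<close>
  have prod: "(\<Prod>j<k. b (n\<^sub>0 + j) / a (n\<^sub>0 + j + 1)) * (-1) ^ k * recurrence_prod a b (n\<^sub>0 + k) n\<^sub>0 * a (n\<^sub>0 + k) = a n\<^sub>0" for k
  proof (induction k)
    case (Suc k)
    then show ?case using nz[of "n\<^sub>0 + k"] nz[of "n\<^sub>0 + k + 1"]
      by (simp add: recurrence_prod_def field_simps)
  qed (simp add: recurrence_prod_def)
  have "s N = (-1) ^ N * \<mu> m * (\<Prod>j<N. b (n\<^sub>0 + j) / a (n\<^sub>0 + j + 1))"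
    using assms(1) by (simp add: recurrence_presentation_def m_def)
  then have "s N * (P * a m) = \<mu> m * a n\<^sub>0"
    unfolding prod[of N, symmetric] P_def m_def by (simp only: mult_ac)
  then have s: "s N = \<mu> m * a n\<^sub>0 / (P * a m)"
    using P0 nz[OF m] by (simp add: field_simps)
  have mu: "\<mu> m = a m * I m + b m * I (Suc m)"
    using assms(2) m by (simp add: recurrence_solution_def)
  have "normalized_tail n\<^sub>0 a b I N - normalized_tail n\<^sub>0 a b I (Suc N) =
      a n\<^sub>0 * I m / P - a n\<^sub>0 * I (Suc m) / (P * (- a m / b m))"
    unfolding normalized_tail_def P_Suc P_def[symmetric] by (simp add: m_def)
  also have "\<dots> = s N"
    unfolding s mu using P0 nz[OF m] by (simp add: field_simps)
  finally show "normalized_tail n\<^sub>0 a b I N - normalized_tail n\<^sub>0 a b I (Suc N) = s N" .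
  show "normalized_tail n\<^sub>0 a b I 0 = a n\<^sub>0 * I n\<^sub>0"
    by (simp add: normalized_tail_def recurrence_prod_def)
qed

text \<open>A witness for summability: the recurrence becomes \<open>I n - I (n + 1) = s n\<close>,
  solved by negative partial sums.\<close>

lemma trivial_presentation:
  "recurrence_presentation s 0 (\<lambda>_. 1) (\<lambda>_. - 1) s"
  "recurrence_solution 0 (\<lambda>_. 1) (\<lambda>_. - 1) s (\<lambda>N. - (\<Sum>k<N. s k))"
  by (simp_all add: recurrence_presentation_def recurrence_solution_def power_mult_distrib[symmetric] mult_ac)

theorem theorem11p1:
  fixes a :: real
  assumes "a > 0"
  shows "C_summable (\<lambda>n. of_real (fact n * a ^ n)) \<and>
         C_sum (\<lambda>n. of_real (fact n * a ^ n)) = of_real (exp (- 1 / a) / a * Ei (1 / a))"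
proof
  define s where "s n = complex_of_real (fact n * a ^ n)" for n
  define v where "v = complex_of_real (exp (- 1 / a) / a * Ei (1 / a))"
  have adm: "M_admissible (normalized_tail n\<^sub>0 \<alpha> \<beta> I)"
    and val: "\<alpha> n\<^sub>0 * I n\<^sub>0 - FP_infinity (normalized_tail n\<^sub>0 \<alpha> \<beta> I) = v"
    if "recurrence_presentation s n\<^sub>0 \<alpha> \<beta> \<mu>" "recurrence_solution n\<^sub>0 \<alpha> \<beta> \<mu> I" for n\<^sub>0 \<alpha> \<beta> \<mu> I
  proof -
    have "normalized_tail n\<^sub>0 \<alpha> \<beta> I N - normalized_tail n\<^sub>0 \<alpha> \<beta> I (Suc N) = complex_of_real (fact N * a ^ N)" for N
      using normalized_tail_diff(1)[OF that] by (simp add: s_def)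
    from FP_infinity_fact_power[of a "normalized_tail n\<^sub>0 \<alpha> \<beta> I", OF assms this]
    show "M_admissible (normalized_tail n\<^sub>0 \<alpha> \<beta> I)"
      "\<alpha> n\<^sub>0 * I n\<^sub>0 - FP_infinity (normalized_tail n\<^sub>0 \<alpha> \<beta> I) = v"
      by (simp_all add: normalized_tail_diff(2)[OF that] v_def)
  qed
  have "C_summable s"
    unfolding C_summable_def using trivial_presentation adm by blast
  then show "C_summable (\<lambda>n. of_real (fact n * a ^ n))" by (simp add: s_def[abs_def])
  \<comment> \<open>\<open>adm\<close> and \<open>val\<close> cover every presentation and solution,
    so the definite description in \<open>C_sum\<close> is justified.\<close>
  have "has_C_sum s w \<longleftrightarrow> w = v" for w
    unfolding has_C_sum_def using trivial_presentation adm val by metis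
  then have "C_sum s = v" unfolding C_sum_def by (intro the_equality) simp_all
  then show "C_sum (\<lambda>n. of_real (fact n * a ^ n)) = of_real (exp (- 1 / a) / a * Ei (1 / a))"
    by (simp only: s_def[abs_def] v_def)
qed

end
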